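(* Let $(u_1, u_2, \ldots, u_k)$ be a $k$-tuple of positive integers such that $\ell c(u_1)-\ell c(u_1-1)\ge \ell c(u_i)-\ell c(u_i-1)$ for all $2\le i\le k$. Then there is a nonnegative integer $N$ with $$N\le \tfrac{3}{13}\log (u_1-1)+\tfrac{3}{13}\sum_{i=2}^k \log (u_i)+8k+4$$ such that for each integer $n\ge N$ there is an orthogonal design $OD\big(2^n\sum_{j=1}^k u_j;\, 2^nu_1, \ldots, 2^nu_k\big)$.
   Context: Here $\log$ is to base $2$, with the convention $\log(0)=0$. An orthogonal design $OD(n;\,u_1,\ldots,u_k)$, with $u_1,\ldots,u_k$ positive integers, is a square matrix $X$ of order $n$ with entries from $\{0,\pm x_1,\ldots,\pm x_k\}$, where $x_1,\ldots,x_k$ are distinct commuting real variables, such that $XX^{t}=\big(\sum_{i=1}^k u_i x_i^2\big)I_n$. A complex Golay number is a positive integer $m$ for which there is a pair of sequences $A=(a_1,\ldots,a_m)$, $B=(b_1,\ldots,b_m)$ with entries in $\{\pm1,\pm i\}\subset\mathbb{C}$ such that $\sum_{r=1}^{m-j}(a_{r+j}\overline{a_r}+b_{r+j}\overline{b_r})=0$ for all $1\le j\le m-1$. For a positive integer $u$, $\ell c(u)$ is the least number of complex Golay numbers (repetitions allowed) that add up to $u$, and $\ell c(0)=0$. *)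

theory Defs
  imports Complex_Main "Jordan_Normal_Form.Matrix"
begin

text \<open>An entry of a design is a formal symbol \<open>0\<close>, \<open>x\<^sub>i\<close> or \<open>- x\<^sub>i\<close>, so the variables
  are distinct by construction. The defining equation of an orthogonal design is required
  for all real values of the variables, which for real polynomials is the same as
  requiring it for indeterminates.\<close>

datatype od_entry = Zero_entry | Plus_var nat | Minus_var nat

fun entry_val :: "(nat \<Rightarrow> real) \<Rightarrow> od_entry \<Rightarrow> real" where
  "entry_val x Zero_entry = 0"
| "entry_val x (Plus_var i) = x i"
| "entry_val x (Minus_var i) = - x i"

definition orthogonal_design :: "nat \<Rightarrow> nat \<Rightarrow> (nat \<Rightarrow> nat) \<Rightarrow> od_entry mat \<Rightarrow> bool" where
  "orthogonal_design n k u X \<longleftrightarrow>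
     (\<forall>i\<in>{1..k}. 0 < u i) \<and>
     X \<in> carrier_mat n n \<and>
     elements_mat X \<subseteq> {Zero_entry} \<union> Plus_var ` {1..k} \<union> Minus_var ` {1..k} \<and>
     (\<forall>x :: nat \<Rightarrow> real.
        map_mat (entry_val x) X * transpose_mat (map_mat (entry_val x) X) =
        (\<Sum>i=1..k. real (u i) * (x i)\<^sup>2) \<cdot>\<^sub>m 1\<^sub>m n)"

definition complex_golay_number :: "nat \<Rightarrow> bool" where
  "complex_golay_number m \<longleftrightarrow> 0 < m \<and>
     (\<exists>a b :: nat \<Rightarrow> complex.
        (\<forall>r\<in>{1..m}. a r \<in> {1, -1, \<i>, -\<i>} \<and> b r \<in> {1, -1, \<i>, -\<i>}) \<and>
        (\<forall>j\<in>{1..m - 1}. (\<Sum>r=1..m - j. a (r + j) * cnj (a r) + b (r + j) * cnj (b r)) = 0))"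

text \<open>The set of lengths is never empty, since \<open>1\<close> is a complex Golay number; the
  empty list gives the value \<open>0\<close> at \<open>0\<close>.\<close>

definition lc :: "nat \<Rightarrow> nat" where
  "lc u = (LEAST l. \<exists>gs. length gs = l \<and> (\<forall>g\<in>set gs. complex_golay_number g) \<and> sum_list gs = u)"

definition log2 :: "real \<Rightarrow> real" where
  "log2 x = (if x = 0 then 0 else log 2 x)"

end

(* Write each u_i as a sum of at most (3/26) log u_i + 4 lengths m of quaternary Golay pairs (a, b).
   Such lengths are closed under (m, n) -> 2mn and include 1, 3, 5, 11, 13, so all
   2^t 3^b 5^c 11^d 13^e with b + c + d + e <= t + 1 occur. These numbers are dense enough for the
   greedy expansion: beyond 2^43 the largest one below u misses u by at most u/407, and
   407^3 > 2^26 pays for one summand with 26/3 bits.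

   Let s be the total number of lengths used and u the sum of the u_i. Over the group ring of
   Z_2u x Z_2 (a character is a pair of a root of unity and a sign chi) each pair contributes, with
   phi the shift to the interval assigned to it, the matrix
     W = [[a phi + (b phi)*, chi (b phi - (a phi)* )], [chi (a phi - (b phi)* ), b phi + (a phi)*]],
   for which W W* = 4m I. Both W and W* have in every row exactly one term at each position of the
   interval and of its mirror image. The Hermitian matrices [[0, W], [W*, 0]] of the s
   pairs, spread over 4^s dimensions with sign factors as in a Jordan-Wigner
   transformation, anticommute. Their sum, weighted by the variables, has one signed variable
   per row, position and sign; multiplying by a Hadamard matrix of order 4^s makes it full, and
   replacing complex entries by real 2 x 2 blocks gives a design for N = 2s + 3. *)
theory Submission imports Defs
begin

section \<open>Quaternary Golay pairs\<close>

definition quaternary :: "complex set" where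
  "quaternary = {1, -1, \<i>, -\<i>}"

lemma quaternary_mult: "x \<in> quaternary \<Longrightarrow> y \<in> quaternary \<Longrightarrow> x * y \<in> quaternary"
  by (auto simp: quaternary_def)

lemma quaternary_cnj: "x \<in> quaternary \<Longrightarrow> cnj x \<in> quaternary"
  by (auto simp: quaternary_def)

lemma quaternary_uminus: "x \<in> quaternary \<Longrightarrow> - x \<in> quaternary"
  by (auto simp: quaternary_def)

lemma quaternary_1: "1 \<in> quaternary"
  by (simp add: quaternary_def)

definition seq_eval :: "nat \<Rightarrow> (nat \<Rightarrow> complex) \<Rightarrow> complex \<Rightarrow> complex" where
  "seq_eval m a w = (\<Sum>j<m. a j * w ^ j)"

text \<open>For quaternary entries the identity on the unit circle is equivalent to the vanishing of
  all summed aperiodic correlations. Values are used because products and shifts act on them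
  multiplicatively.\<close>

definition golay_pair :: "nat \<Rightarrow> (nat \<Rightarrow> complex) \<Rightarrow> (nat \<Rightarrow> complex) \<Rightarrow> bool" where
  "golay_pair m a b \<longleftrightarrow> range a \<subseteq> quaternary \<and> range b \<subseteq> quaternary \<and>
     (\<forall>w. w * cnj w = 1 \<longrightarrow>
        seq_eval m a w * cnj (seq_eval m a w) + seq_eval m b w * cnj (seq_eval m b w) = of_nat (2 * m))"

lemma unit_power: "z ^ n * cnj (z ^ n) = 1" if "z * cnj z = (1::complex)"
  using that by (simp flip: power_mult_distrib)

lemma sum_lessThan_add: "(\<Sum>p<m + n. f p) = (\<Sum>p<n. f p) + (\<Sum>q<m. f (n + q))"
  for f :: "nat \<Rightarrow> 'a::comm_monoid_add"
  by (induction m) (simp_all add: ac_simps)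

text \<open>Products \<open>a i * cnj (a j)\<close> are grouped by the lag \<open>i - j\<close>. In
  the induction, the cross terms of the last entry with the earlier ones supply one new product for
  each lag.\<close>

lemma seq_eval_norm:
  assumes "w * cnj w = 1"
  shows "seq_eval m a w * cnj (seq_eval m a w) = (\<Sum>j<m. a j * cnj (a j)) +
    (\<Sum>k\<in>{1..<m}. (\<Sum>j<m - k. a (j + k) * cnj (a j)) * w ^ k +
       cnj ((\<Sum>j<m - k. a (j + k) * cnj (a j)) * w ^ k))"
proof (induction m)
  case 0
  then show ?case by (simp add: seq_eval_def)
next
  case (Suc m)
  define C where "C m k = (\<Sum>j<m - k. a (j + k) * cnj (a j))" for m k
  define S where "S = seq_eval m a w"
  have ww: "w ^ m * cnj (w ^ m) = 1" by (rule unit_power[OF assms])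
  have shift: "w ^ m * cnj (w ^ (m - k)) = w ^ k" if "k \<le> m" for k
  proof -
    have "w ^ m = w ^ k * w ^ (m - k)" using that by (simp flip: power_add)
    then show ?thesis by (simp only: mult.assoc unit_power[OF assms] mult_1_right)
  qed
  have cross: "a m * w ^ m * cnj S = (\<Sum>k\<in>{1..<Suc m}. a m * cnj (a (m - k)) * w ^ k)"
  proof -
    have "a m * w ^ m * cnj S = (\<Sum>j<m. a m * cnj (a j) * (w ^ m * cnj (w ^ j)))"
      by (simp add: S_def seq_eval_def sum_distrib_left mult_ac)
    also have "\<dots> = (\<Sum>k\<in>{1..<Suc m}. a m * cnj (a (m - k)) * (w ^ m * cnj (w ^ (m - k))))"
      by (rule sum.reindex_bij_witness[of _ "\<lambda>k. m - k" "\<lambda>j. m - j"]) auto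
    also have "\<dots> = (\<Sum>k\<in>{1..<Suc m}. a m * cnj (a (m - k)) * w ^ k)"
      by (intro sum.cong refl) (simp add: shift del: complex_cnj_power)
    finally show ?thesis .
  qed
  have CS: "C (Suc m) k = C m k + a m * cnj (a (m - k))" if "k \<in> {1..<Suc m}" for k
    using that by (simp add: C_def Suc_diff_le)
  \<comment> \<open>At lag \<open>m\<close> the old correlation is an empty sum, so the lags may run
    up to \<open>m\<close> instead of \<open>m - 1\<close>.\<close>
  have Cm: "C m m = 0" by (simp add: C_def)
  have "seq_eval (Suc m) a w * cnj (seq_eval (Suc m) a w) =
      (S + a m * w ^ m) * cnj (S + a m * w ^ m)"
    by (simp add: S_def seq_eval_def)
  also have "\<dots> = S * cnj S + a m * cnj (a m) * (w ^ m * cnj (w ^ m)) +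
      (a m * w ^ m * cnj S + cnj (a m * w ^ m * cnj S))"
    by (simp add: algebra_simps)
  also have "\<dots> = (\<Sum>j<Suc m. a j * cnj (a j)) +
      ((\<Sum>k\<in>{1..<Suc m}. C m k * w ^ k + cnj (C m k * w ^ k)) +
       (\<Sum>k\<in>{1..<Suc m}. a m * cnj (a (m - k)) * w ^ k + cnj (a m * cnj (a (m - k)) * w ^ k)))"
    unfolding cross ww Suc.IH[folded C_def S_def] cnj_sum
    by (cases "m = 0") (simp_all add: Cm sum.distrib atLeastLessThanSuc)
  also have "(\<Sum>k\<in>{1..<Suc m}. C m k * w ^ k + cnj (C m k * w ^ k)) +
       (\<Sum>k\<in>{1..<Suc m}. a m * cnj (a (m - k)) * w ^ k + cnj (a m * cnj (a (m - k)) * w ^ k)) =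
      (\<Sum>k\<in>{1..<Suc m}. C (Suc m) k * w ^ k + cnj (C (Suc m) k * w ^ k))"
    unfolding sum.distrib[symmetric] by (intro sum.cong refl) (simp add: CS algebra_simps)
  finally show ?case by (simp add: C_def)
qed

section \<open>Explicit pairs of small length\<close>

definition list_correlation :: "complex list \<Rightarrow> nat \<Rightarrow> complex" where
  "list_correlation xs k = (\<Sum>(x, y)\<leftarrow>zip (drop k xs) xs. x * cnj y)"

text \<open>The default 1 beyond the end keeps the whole range quaternary.\<close>

definition seq_of_list :: "complex list \<Rightarrow> nat \<Rightarrow> complex" where
  "seq_of_list xs j = (if j < length xs then xs ! j else 1)"

lemma list_correlation_eq:
  "list_correlation xs k = (\<Sum>j<length xs - k. seq_of_list xs (j + k) * cnj (seq_of_list xs j))"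
  unfolding list_correlation_def sum_list_sum_nth
  by (auto simp: atLeast0LessThan seq_of_list_def add.commute intro!: sum.cong)

text \<open>The \<open>2 * m\<close> entries have modulus 1 and give the constant term; the terms of
  positive lag cancel because the correlations add up to 0.\<close>

lemma golay_pair_of_lists:
  assumes "length xs = m" "length ys = m" "set xs \<subseteq> quaternary" "set ys \<subseteq> quaternary"
    and corr: "\<forall>k\<in>set [1..<m]. list_correlation xs k + list_correlation ys k = 0"
  shows "golay_pair m (seq_of_list xs) (seq_of_list ys)"
proof -
  define a where "a = seq_of_list xs"
  define b where "b = seq_of_list ys"
  have quat: "a j \<in> quaternary" "b j \<in> quaternary" for j
    using assms(3,4) nth_mem unfolding a_def b_def seq_of_list_def by (auto simp: quaternary_1)
  have unit: "x * cnj x = 1" if "x \<in> quaternary" for x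
    using that by (auto simp: quaternary_def)
  have "seq_eval m a w * cnj (seq_eval m a w) + seq_eval m b w * cnj (seq_eval m b w) = of_nat (2 * m)"
    if w: "w * cnj w = 1" for w
  proof -
    define A where "A k = (\<Sum>j<m - k. a (j + k) * cnj (a j))" for k
    define B where "B k = (\<Sum>j<m - k. b (j + k) * cnj (b j))" for k
    have AB: "A k + B k = 0" if "k \<in> {1..<m}" for k
      using corr that unfolding list_correlation_eq assms(1,2) A_def B_def a_def b_def by simp
    have "(\<Sum>k\<in>{1..<m}. A k * w ^ k + cnj (A k * w ^ k)) + (\<Sum>k\<in>{1..<m}. B k * w ^ k + cnj (B k * w ^ k)) =
        (\<Sum>k\<in>{1..<m}. (A k + B k) * w ^ k + cnj ((A k + B k) * w ^ k))"
      unfolding sum.distrib[symmetric] by (intro sum.cong refl) (simp add: algebra_simps)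
    also have "\<dots> = 0"
      by (intro sum.neutral ballI) (simp only: AB, simp)
    finally show ?thesis
      unfolding seq_eval_norm[OF w] A_def[symmetric] B_def[symmetric] unit[OF quat(1)] unit[OF quat(2)]
      by (simp add: algebra_simps)
  qed
  then show ?thesis
    using quat by (auto simp: golay_pair_def a_def b_def)
qed

definition golay_length :: "nat \<Rightarrow> bool" where
  "golay_length m \<longleftrightarrow> 0 < m \<and> (\<exists>a b. golay_pair m a b)"

lemma golay_length_of_lists:
  assumes "length xs = m" "length ys = m" "0 < m" "set xs \<subseteq> quaternary" "set ys \<subseteq> quaternary"
    and "\<forall>k\<in>set [1..<m]. list_correlation xs k + list_correlation ys k = 0"
  shows "golay_length m"
  using golay_pair_of_lists assms unfolding golay_length_def by blast

lemma golay_length_1: "golay_length 1"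
  by (rule golay_length_of_lists[of "[1]" _ "[1]"]) (auto simp: quaternary_def)

text \<open>Lengths 3, 5, 11 and 13 rest on explicit pairs whose correlations at every lag are
  evaluated by simplification.\<close>

lemma golay_length_3: "golay_length 3"
  by (rule golay_length_of_lists[of "[1, 1, -1]" _ "[1, \<i>, 1]"])
     (simp_all add: quaternary_def list_correlation_def upt_rec)

lemma golay_length_5: "golay_length 5"
  by (rule golay_length_of_lists[of "[1, 1, 1, \<i>, -\<i>]" _ "[1, -\<i>, -1, 1, \<i>]"])
     (simp_all add: quaternary_def list_correlation_def upt_rec)

lemma golay_length_11: "golay_length 11"
  by (rule golay_length_of_lists[of "[1, 1, -\<i>, -\<i>, -\<i>, 1, 1, \<i>, -1, 1, -1]" _
        "[1, \<i>, -1, 1, -1, \<i>, -\<i>, -1, \<i>, \<i>, 1]"])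
     (simp_all add: quaternary_def list_correlation_def upt_rec)

lemma golay_length_13: "golay_length 13"
  by (rule golay_length_of_lists[of "[1, 1, 1, -\<i>, -1, 1, 1, \<i>, 1, -1, 1, \<i>, -\<i>]" _
        "[1, -\<i>, -1, -1, -1, -\<i>, -1, 1, 1, \<i>, -1, 1, \<i>]"])
     (simp_all add: quaternary_def list_correlation_def upt_rec)

section \<open>Multiplication of Golay lengths\<close>

lemma sum_lessThan_mult: "(\<Sum>j<n * K. f j) = (\<Sum>q<n. \<Sum>r<K. f (q * K + r))"
  for f :: "nat \<Rightarrow> 'a::comm_monoid_add"
  by (induction n) (simp_all add: sum_lessThan_add)

text \<open>Conjugation inverts \<open>w\<close> on the unit circle, so it also reverses the order
  of the coefficients, up to the factor \<open>w ^ (n - 1)\<close>.\<close>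

lemma seq_eval_cnj_rev:
  assumes "w * cnj w = 1"
  shows "seq_eval n (\<lambda>q. cnj (d (n - 1 - q))) w = w ^ (n - 1) * cnj (seq_eval n d w)"
proof -
  have "seq_eval n (\<lambda>q. cnj (d (n - 1 - q))) w = (\<Sum>q<n. cnj (d q) * w ^ (n - 1 - q))"
    unfolding seq_eval_def
    by (rule sum.reindex_bij_witness[of _ "\<lambda>q. n - 1 - q" "\<lambda>q. n - 1 - q"]) auto
  also have "\<dots> = (\<Sum>q<n. w ^ (n - 1) * cnj (d q * w ^ q))"
  proof (intro sum.cong refl)
    fix q assume "q \<in> {..<n}"
    then have "w ^ (n - 1) = w ^ (n - 1 - q) * w ^ q" by (simp flip: power_add)
    then have "w ^ (n - 1) * cnj (w ^ q) = w ^ (n - 1 - q)"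
      by (simp only: mult.assoc unit_power[OF assms] mult_1_right)
    then show "cnj (d q) * w ^ (n - 1 - q) = w ^ (n - 1) * cnj (d q * w ^ q)"
      by (simp add: mult_ac)
  qed
  finally show ?thesis
    by (simp add: seq_eval_def sum_distrib_left cnj_sum)
qed

text \<open>Disjoint supports of \<open>a\<close> and \<open>b\<close> keep the entries quaternary, at the cost of the factor 2. The
  mixed terms of the norms cancel for reversed conjugates in place of \<open>d\<close>.\<close>

definition interleave_product ::
  "nat \<Rightarrow> (nat \<Rightarrow> complex) \<Rightarrow> (nat \<Rightarrow> complex) \<Rightarrow> (nat \<Rightarrow> complex) \<Rightarrow> (nat \<Rightarrow> complex) \<Rightarrow> nat \<Rightarrow> complex" where
  "interleave_product m a b c d j = (let q = j div (2 * m); r = j mod (2 * m)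
     in if r < m then c q * a r else d q * b (r - m))"

lemma seq_eval_interleave_product:
  assumes "m > 0"
  shows "seq_eval (n * (2 * m)) (interleave_product m a b c d) w =
    seq_eval n c (w ^ (2 * m)) * seq_eval m a w + w ^ m * seq_eval n d (w ^ (2 * m)) * seq_eval m b w"
proof -
  have *: "interleave_product m a b c d (q * (2 * m) + r) = c q * a r"
          "interleave_product m a b c d (q * (2 * m) + (m + r)) = d q * b r" if "r < m" for q r
    using that assms by (simp_all add: interleave_product_def Let_def)
  have "seq_eval (n * (2 * m)) (interleave_product m a b c d) w = (\<Sum>q<n.
      (\<Sum>r<m. c q * a r * w ^ (q * (2 * m) + r)) + (\<Sum>r<m. d q * b r * w ^ (q * (2 * m) + (m + r))))"
    unfolding seq_eval_def sum_lessThan_mult[where n = n]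
  proof (intro sum.cong refl)
    fix q
    show "(\<Sum>r<2 * m. interleave_product m a b c d (q * (2 * m) + r) * w ^ (q * (2 * m) + r)) =
      (\<Sum>r<m. c q * a r * w ^ (q * (2 * m) + r)) + (\<Sum>r<m. d q * b r * w ^ (q * (2 * m) + (m + r)))"
      unfolding mult_2[of m] sum_lessThan_add by (simp add: *[unfolded mult_2[of m]])
  qed
  also have "\<dots> = (\<Sum>q<n. c q * (w ^ (2 * m)) ^ q * seq_eval m a w +
      w ^ m * (d q * (w ^ (2 * m)) ^ q) * seq_eval m b w)"
    unfolding seq_eval_def sum_distrib_left
    by (intro sum.cong refl arg_cong2[of _ _ _ _ "(+)"])
       (simp_all add: power_add mult_ac flip: power_mult)
  finally show ?thesis
    unfolding seq_eval_def[of n] by (simp add: sum.distrib sum_distrib_left sum_distrib_right)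
qed

text \<open>The new values are \<open>C * A + s * cnj D * B\<close> and
  \<open>D * A - s * cnj C * B\<close> with \<open>s\<close> of modulus 1. Their mixed terms are
  opposite, so the norms multiply to \<open>2 * n * (2 * m)\<close>, twice the new length.\<close>

lemma golay_length_mult:
  assumes "golay_length m" "golay_length n"
  shows "golay_length (2 * m * n)"
proof -
  obtain a b where ab: "golay_pair m a b" and m: "0 < m"
    using assms(1) by (auto simp: golay_length_def)
  obtain c d where cd: "golay_pair n c d" and n: "0 < n"
    using assms(2) by (auto simp: golay_length_def)
  define e where "e = interleave_product m a b c (\<lambda>q. cnj (d (n - 1 - q)))"
  define f where "f = interleave_product m a b d (\<lambda>q. - cnj (c (n - 1 - q)))"
  have "range e \<subseteq> quaternary" "range f \<subseteq> quaternary"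
    using ab cd unfolding golay_pair_def e_def f_def interleave_product_def Let_def
    by (auto simp: image_subset_iff quaternary_mult quaternary_cnj quaternary_uminus
        simp del: mult_minus_left)
  moreover have "seq_eval (n * (2 * m)) e w * cnj (seq_eval (n * (2 * m)) e w) +
      seq_eval (n * (2 * m)) f w * cnj (seq_eval (n * (2 * m)) f w) = of_nat (2 * (n * (2 * m)))"
    if w: "w * cnj w = 1" for w
  proof -
    define W where "W = w ^ (2 * m)"
    have W: "W * cnj W = 1" unfolding W_def by (rule unit_power[OF w])
    define A B C D where "A = seq_eval m a w" and "B = seq_eval m b w"
      and "C = seq_eval n c W" and "D = seq_eval n d W"
    \<comment> \<open>\<open>w ^ m\<close> comes from placing \<open>b\<close> in the second half of
      each period, \<open>W ^ (n - 1)\<close> from the reversal.\<close>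
    define s where "s = w ^ m * W ^ (n - 1)"
    have s: "s * cnj s = 1"
    proof -
      have "s * cnj s = (w ^ m * cnj (w ^ m)) * (W ^ (n - 1) * cnj (W ^ (n - 1)))"
        by (simp add: s_def mult_ac)
      then show ?thesis by (simp only: unit_power[OF w] unit_power[OF W] mult_1)
    qed
    have neg: "seq_eval n (\<lambda>q. - cnj (c (n - 1 - q))) W = - seq_eval n (\<lambda>q. cnj (c (n - 1 - q))) W"
      by (simp add: seq_eval_def sum_negf)
    have e: "seq_eval (n * (2 * m)) e w = C * A + s * cnj D * B"
      unfolding e_def seq_eval_interleave_product[OF m] W_def[symmetric] seq_eval_cnj_rev[OF W]
      by (simp add: A_def B_def C_def D_def s_def mult_ac)
    have f: "seq_eval (n * (2 * m)) f w = D * A - s * cnj C * B"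
      unfolding f_def seq_eval_interleave_product[OF m] W_def[symmetric] neg seq_eval_cnj_rev[OF W]
      by (simp add: A_def B_def C_def D_def s_def mult_ac)
    have "seq_eval (n * (2 * m)) e w * cnj (seq_eval (n * (2 * m)) e w) +
        seq_eval (n * (2 * m)) f w * cnj (seq_eval (n * (2 * m)) f w) =
        (C * cnj C + D * cnj D) * (A * cnj A + (s * cnj s) * (B * cnj B))"
      unfolding e f by (simp add: algebra_simps)
    also have "\<dots> = of_nat (2 * n) * of_nat (2 * m)"
    proof -
      have "C * cnj C + D * cnj D = of_nat (2 * n)"
        using cd W unfolding golay_pair_def C_def D_def by blast
      moreover have "A * cnj A + B * cnj B = of_nat (2 * m)"
        using ab w unfolding golay_pair_def A_def B_def by blast
      ultimately show ?thesis by (simp only: s mult_1)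
    qed
    finally show ?thesis by simp
  qed
  ultimately have "golay_pair (n * (2 * m)) e f"
    unfolding golay_pair_def by blast
  then show ?thesis
    using m n unfolding golay_length_def by (metis mult.commute nat_0_less_mult_iff zero_less_numeral)
qed

section \<open>Expansions into few Golay lengths\<close>

lemma golay_length_2_power_mult: "golay_length m \<Longrightarrow> golay_length (2 ^ t * m)"
proof (induction t)
  case (Suc t)
  then show ?case
    using golay_length_mult[OF _ golay_length_1, of "2 ^ t * m"] by (simp add: mult.assoc)
qed simp

lemma golay_length_prod_list:
  assumes "golay_length m" "\<forall>p\<in>set ps. golay_length p"
  shows "golay_length (2 ^ length ps * prod_list ps * m)"
  using assms(2)
proof (induction ps)
  case (Cons p ps)
  then show ?case
    using golay_length_mult[of p "2 ^ length ps * prod_list ps * m"] by (simp add: mult_ac)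
qed (use assms(1) in simp)

text \<open>Values are integers because numerals of type \<open>nat\<close> are evaluated in unary.\<close>

type_synonym smooth_code = "nat \<times> nat \<times> nat \<times> nat \<times> nat"

fun smooth_value :: "smooth_code \<Rightarrow> int" where
  "smooth_value (t, b, c, d, e) = 2 ^ t * 3 ^ b * 5 ^ c * 11 ^ d * 13 ^ e"

fun smooth_code_ok :: "smooth_code \<Rightarrow> bool" where
  "smooth_code_ok (t, b, c, d, e) \<longleftrightarrow> b + c + d + e \<le> t + 1"

text \<open>A product of \<open>r\<close> lengths among 3, 5, 11, 13 needs only \<open>r - 1\<close>
  factors 2, whence the bound \<open>t + 1\<close>; surplus factors 2 come from multiplication with
  the length 1.\<close>

lemma golay_length_smooth:
  assumes "smooth_code_ok s"
  shows "golay_length (nat (smooth_value s))"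
proof -
  obtain t b c d e where s: "s = (t, b, c, d, e)" by (metis prod_cases5)
  define ps :: "nat list" where "ps = replicate b 3 @ replicate c 5 @ replicate d 11 @ replicate e 13"
  have ps: "\<forall>p\<in>set ps. golay_length p"
    using golay_length_3 golay_length_5 golay_length_11 golay_length_13 by (auto simp: ps_def)
  have len: "length ps \<le> t + 1"
    using assms by (simp add: ps_def s)
  have "smooth_value s = int (2 ^ t * prod_list ps)"
    by (simp add: s ps_def prod_list_replicate)
  then have val: "nat (smooth_value s) = 2 ^ t * prod_list ps"
    by (simp only: nat_int)
  show ?thesis
  proof (cases ps)
    case Nil
    then show ?thesis
      unfolding val using golay_length_2_power_mult[OF golay_length_1, of t] by simp
  next
    case (Cons p qs)
    \<comment> \<open>The first prime is the seed of the product; only the primes in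
      \<open>qs\<close> consume a factor 2 each.\<close>
    have "golay_length (2 ^ length qs * prod_list qs * p)"
      using ps by (intro golay_length_prod_list) (auto simp: Cons)
    then have "golay_length (2 ^ (t - length qs) * (2 ^ length qs * prod_list qs * p))"
      by (rule golay_length_2_power_mult)
    moreover have "2 ^ t = 2 ^ (t - length qs) * (2 ^ length qs :: nat)"
      using len by (simp add: Cons flip: power_add)
    ultimately show ?thesis
      unfolding val by (simp add: Cons mult_ac)
  qed
qed

section \<open>Sums of few Golay lengths\<close>

definition golay_sum :: "nat \<Rightarrow> nat \<Rightarrow> bool" where
  "golay_sum l u \<longleftrightarrow> (\<exists>gs. length gs \<le> l \<and> (\<forall>g\<in>set gs. golay_length g) \<and> sum_list gs = u)"

lemma golay_sum_0: "golay_sum l 0"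
  unfolding golay_sum_def by (rule exI[of _ "[]"]) simp

lemma golay_sum_mono: "golay_sum l u \<Longrightarrow> l \<le> l' \<Longrightarrow> golay_sum l' u"
  unfolding golay_sum_def using le_trans by blast

lemma golay_sum_Suc:
  assumes "golay_length g" "g \<le> u" "golay_sum l (u - g)"
  shows "golay_sum (Suc l) u"
proof -
  obtain gs where "length gs \<le> l" "\<forall>g\<in>set gs. golay_length g" "sum_list gs = u - g"
    using assms(3) by (auto simp: golay_sum_def)
  then show ?thesis
    unfolding golay_sum_def using assms(1,2) by (intro exI[of _ "g # gs"]) auto
qed

text \<open>A computable certificate: each value exceeds its predecessor by at most
  \<open>gap + 1\<close>, so every integer from \<open>lo\<close> to \<open>hi\<close> lies at most
  \<open>gap\<close> above \<open>lo\<close> or above a listed value.\<close>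

fun covers :: "int \<Rightarrow> int \<Rightarrow> smooth_code list \<Rightarrow> int \<Rightarrow> bool" where
  "covers gap lo [] hi \<longleftrightarrow> hi \<le> lo + gap"
| "covers gap lo (s # ss) hi \<longleftrightarrow>
     smooth_code_ok s \<and> (let v = smooth_value s in v \<le> lo + gap + 1 \<and> covers gap v ss hi)"

lemma smooth_value_pos: "0 < smooth_value s"
  by (cases s rule: smooth_value.cases) simp

text \<open>Walk along the list until the next value exceeds \<open>u\<close>; then \<open>u\<close>
  is at most \<open>gap\<close> above the current one. The first alternative is for the start
  \<open>lo\<close>, which may fail to be a Golay length.\<close>

lemma coversD:
  assumes "covers gap lo ss hi" "lo \<le> int u" "int u \<le> hi"
  shows "int u \<le> lo + gap \<or> (\<exists>g. golay_length g \<and> g \<le> u \<and> int (u - g) \<le> gap)"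
  using assms
proof (induction ss arbitrary: lo)
  case (Cons s ss)
  define v where "v = smooth_value s"
  have s: "smooth_code_ok s" "v \<le> lo + gap + 1" "covers gap v ss hi"
    using Cons.prems(1) by (auto simp: v_def Let_def)
  show ?case
  proof (cases "v \<le> int u")
    case True
    have "golay_length (nat v)" "nat v \<le> u"
      using golay_length_smooth[OF s(1)] True by (auto simp: v_def)
    moreover have "int (u - nat v) \<le> gap" if "int u \<le> v + gap"
      using that True smooth_value_pos[of s] by (simp add: v_def of_nat_diff)
    ultimately show ?thesis
      using Cons.IH[OF s(3) True Cons.prems(3)] by blast
  next
    case False
    then show ?thesis using s(2) by simp
  qed
qed simp

lemma golay_sum_cover:
  assumes "covers gap 0 ss hi" "\<And>v. int v \<le> gap \<Longrightarrow> golay_sum l v" "int u \<le> hi" "l' = l + 1"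
  shows "golay_sum l' u"
  unfolding assms(4) Suc_eq_plus1[symmetric]
  using coversD[OF assms(1) _ assms(3)] assms(2) golay_sum_Suc golay_sum_mono[of l u "Suc l"] by fastforce

text \<open>Relative analogue of \<open>covers\<close>: a step enlarges the value by at most one
  part in \<open>D\<close>. The chain ends exactly at \<open>hi\<close>, so nothing below
  \<open>hi\<close> is left uncovered.\<close>

fun refines :: "int \<Rightarrow> int \<Rightarrow> smooth_code list \<Rightarrow> int \<Rightarrow> bool" where
  "refines D lo [] hi \<longleftrightarrow> lo = hi"
| "refines D lo (s # ss) hi \<longleftrightarrow>
     smooth_code_ok s \<and> (let v = smooth_value s in D * (v - lo) \<le> lo \<and> refines D v ss hi)"

text \<open>The error is measured from \<open>q + 1\<close> because \<open>q\<close> will be the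
  integer part of a scaled number, which may lie anywhere below \<open>q + 1\<close>.\<close>

lemma refinesD:
  assumes "refines D lo ss hi" "golay_length (nat lo)" "0 \<le> D" "0 < lo" "lo \<le> int q" "int q < hi"
  shows "\<exists>g. golay_length g \<and> g \<le> q \<and> D * (int q + 1 - int g) \<le> int g"
  using assms
proof (induction ss arbitrary: lo)
  case (Cons s ss)
  define v where "v = smooth_value s"
  have s: "smooth_code_ok s" "D * (v - lo) \<le> lo" "refines D v ss hi"
    using Cons.prems(1) by (auto simp: v_def Let_def)
  show ?case
  proof (cases "v \<le> int q")
    case True
    then show ?thesis
      using Cons.IH[OF s(3) _ Cons.prems(3)] golay_length_smooth[OF s(1)] smooth_value_pos[of s] Cons.prems(6)
      by (simp add: v_def)
  next
    case False
    then have "D * (int q + 1 - lo) \<le> D * (v - lo)"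
      using Cons.prems(3) by (intro mult_left_mono) auto
    then show ?thesis
      using s(2) Cons.prems(2,4,5) by (intro exI[of _ "nat lo"]) auto
  qed
qed simp

text \<open>The lists below are greedy: each value is the largest admissible one, apart from early stops.
  All \<open>u\<close> up to the last argument of \<open>covers\<close> need one summand more than those up to the first.\<close>

lemma covers_1: "covers 0 0
    [(0,0,0,0,0), (1,0,0,0,0), (0,1,0,0,0), (2,0,0,0,0), (0,0,1,0,0), (1,1,0,0,0)] 6"
  by code_simp

lemma golay_sum_upto_1: "u \<le> 6 \<Longrightarrow> golay_sum 1 u"
  by (rule golay_sum_cover[OF covers_1, of 0]) (simp_all add: golay_sum_0)

lemma covers_2: "covers 6 0
    [(1,1,0,0,0), (0,0,0,0,1), (2,0,1,0,0), (1,0,0,0,1), (5,0,0,0,0), (2,2,0,0,0), (3,0,1,0,0),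
     (2,0,0,1,0), (1,0,2,0,0)] 56"
  by code_simp

lemma golay_sum_upto_2: "u \<le> 56 \<Longrightarrow> golay_sum 2 u"
  by (rule golay_sum_cover[OF covers_2, of 1]) (simp_all add: golay_sum_upto_1[simplified])

lemma covers_3: "covers 56 0
    [(2,0,0,0,1), (2,3,0,0,0), (5,0,1,0,0), (3,3,0,0,0), (3,1,0,1,0), (6,0,1,0,0), (3,2,1,0,0),
     (5,0,0,0,1), (2,2,0,0,1), (3,0,1,0,1), (6,2,0,0,0), (4,1,0,0,1), (2,0,0,0,2), (4,2,1,0,0),
     (8,1,0,0,0), (5,0,2,0,0), (6,0,0,0,1), (4,0,1,1,0), (3,2,0,0,1), (3,0,0,2,0), (10,0,0,0,0),
     (3,3,1,0,0), (2,0,2,1,0), (7,2,0,0,0), (4,1,2,0,0), (5,1,0,0,1), (2,0,2,0,1), (3,0,0,0,2),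
     (7,0,0,1,0), (2,1,0,2,0)] 1508"
  by code_simp

lemma golay_sum_upto_3: "u \<le> 1508 \<Longrightarrow> golay_sum 3 u"
  by (rule golay_sum_cover[OF covers_3, of 2]) (simp_all add: golay_sum_upto_2)

lemma covers_4: "covers 1508 0
    [(2,1,0,2,0), (3,1,0,2,0), (4,0,2,1,0), (4,1,0,2,0), (5,2,2,0,0), (6,3,1,0,0), (4,0,4,0,0),
     (4,0,1,1,1), (9,0,2,0,0), (4,4,0,1,0), (4,1,2,0,1), (9,1,0,1,0), (7,0,0,1,1), (5,0,1,2,0),
     (6,0,2,0,1), (4,0,3,1,0), (5,6,0,0,0), (13,1,0,0,0), (4,0,3,0,1), (6,1,0,1,1), (7,2,2,0,0),
     (4,1,4,0,0), (5,1,2,0,1), (6,1,0,0,2), (3,0,2,0,2), (7,0,2,1,0), (8,0,0,1,1), (7,3,0,1,0),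
     (5,5,1,0,0), (6,0,4,0,0), (9,4,0,0,0), (5,0,0,3,0), (5,0,3,1,0), (12,0,0,1,0), (7,1,0,2,0),
     (5,3,1,1,0), (5,2,0,0,2), (4,0,5,0,0), (11,0,2,0,0), (4,3,0,2,0), (12,0,0,0,1), (6,0,1,0,2),
     (11,3,0,0,0), (10,0,1,1,0), (8,2,2,0,0), (5,1,1,2,0), (5,0,0,1,2), (5,1,4,0,0), (12,1,1,0,0),
     (3,0,1,2,1), (9,0,3,0,0), (7,1,0,0,2), (4,1,3,1,0), (6,4,0,0,1), (5,1,1,1,1), (6,2,0,2,0),
     (8,0,2,1,0)] 71908"
  by code_simp

lemma golay_sum_upto_4: "u \<le> 71908 \<Longrightarrow> golay_sum 4 u"
  by (rule golay_sum_cover[OF covers_4, of 3]) (simp_all add: golay_sum_upto_3)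

lemma covers_5: "covers 71908 0
    [(8,0,2,1,0), (9,0,2,1,0), (8,1,2,1,0), (10,0,2,1,0), (8,0,3,1,0), (9,1,2,1,0), (7,3,0,1,1),
     (11,0,2,1,0), (8,2,2,1,0), (9,0,3,1,0), (8,0,2,2,0), (10,1,2,1,0), (8,0,2,1,1), (16,1,1,0,0),
     (5,1,1,0,3), (12,0,2,1,0), (11,2,1,0,1), (9,2,2,1,0), (12,0,2,0,1), (7,7,1,0,0),
     (11,0,1,1,1), (12,1,3,0,0), (5,3,0,1,2), (9,3,0,2,0), (6,2,2,2,0), (7,2,0,2,1), (6,5,0,2,0),
     (8,2,1,0,2), (8,0,1,2,1), (8,0,4,0,1), (7,2,0,1,2), (14,3,1,0,0), (9,4,1,1,0), (14,0,0,1,1),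
     (8,1,5,0,0), (7,3,1,1,1), (10,2,2,1,0), (6,0,5,0,1), (13,0,2,0,1), (11,0,0,3,0), (9,2,1,2,0),
     (9,1,0,1,2), (7,3,1,0,2), (12,6,0,0,0), (4,0,0,4,1), (11,2,0,0,2), (8,2,3,1,0), (10,5,0,0,1),
     (9,2,1,1,1), (9,8,0,0,0), (8,5,1,1,0), (7,2,2,2,0), (17,3,0,0,0), (16,0,1,1,0), (10,0,2,1,1),
     (10,6,1,0,0), (9,3,2,1,0), (8,0,3,2,0), (18,1,1,0,0), (8,0,6,0,0), (6,1,3,0,2), (7,2,2,1,1),
     (8,3,1,2,0), (4,0,0,2,3), (8,3,4,0,0), (6,4,1,0,2), (7,5,0,1,1), (14,0,2,1,0), (8,0,3,1,1),
     (9,1,2,2,0), (15,0,0,1,1), (7,3,3,1,0), (9,1,5,0,0), (7,2,2,0,2), (16,1,2,0,0), (5,2,0,3,1),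
     (8,9,0,0,0), (11,2,2,1,0), (7,6,1,1,0), (7,0,5,0,1), (12,2,0,1,1), (14,0,2,0,1),
     (10,4,1,0,1), (12,0,0,3,0), (9,1,2,1,1), (15,0,0,0,2), (9,7,1,0,0), (12,0,3,1,0),
     (8,4,2,1,0), (19,0,0,1,0), (7,1,3,2,0), (13,0,1,1,1), (17,2,1,0,0), (7,0,2,1,2), (7,1,6,0,0),
     (7,6,1,0,1), (9,2,0,3,0), (11,0,2,2,0), (8,1,4,0,1), (5,0,3,2,1), (9,2,3,1,0), (11,0,5,0,0),
     (11,5,0,0,1), (9,1,2,0,2), (18,0,2,0,0), (6,1,5,1,0), (12,0,3,0,1), (10,8,0,0,0),
     (6,0,4,0,2)] 6831908"
  by code_simp

lemma golay_sum_upto_5: "u \<le> 6831908 \<Longrightarrow> golay_sum 5 u"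
  by (rule golay_sum_cover[OF covers_5, of 4]) (simp_all add: golay_sum_upto_4)

lemma covers_6: "covers 6831908 0
    [(19,0,0,0,1), (20,0,0,0,1), (19,1,0,0,1), (21,0,0,0,1), (19,0,1,0,1), (20,1,0,0,1),
     (10,0,2,1,2), (8,3,1,2,1), (15,0,0,1,2), (8,7,0,2,0), (6,0,4,1,2), (8,1,4,0,2), (6,0,4,0,3),
     (8,7,0,0,2), (13,2,3,1,0), (10,0,4,0,2), (8,0,5,1,1), (11,10,0,0,0), (19,5,0,0,0),
     (27,0,0,0,0), (12,0,5,1,0), (17,2,3,0,0), (10,4,0,1,2), (9,0,0,1,4), (13,0,0,2,2),
     (8,2,4,2,0), (6,2,0,1,4), (18,0,1,1,1), (12,6,1,0,1), (12,4,1,2,0), (12,4,4,0,0),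
     (9,2,2,1,2), (11,4,0,3,0), (7,0,0,6,0), (18,4,0,1,0), (10,1,7,0,0), (11,7,1,1,0),
     (9,2,2,0,3), (12,1,3,0,2), (15,0,4,0,1), (22,0,1,0,1), (11,2,3,2,0), (11,1,2,1,2),
     (9,1,0,4,1), (16,3,0,0,2), (15,0,1,1,2), (11,5,4,0,0), (19,0,1,2,0), (14,2,0,0,3),
     (11,0,0,5,0), (13,5,0,0,2), (8,1,5,1,1), (12,8,0,0,1), (11,5,1,1,1), (10,2,2,2,1),
     (25,0,0,1,0), (19,0,1,1,1), (13,0,2,1,2), (10,0,5,2,0), (20,1,3,0,0), (10,0,8,0,0),
     (9,8,0,2,0), (18,0,0,2,1), (12,0,1,2,2), (6,0,2,2,3), (10,3,6,0,0), (10,1,1,0,4),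
     (11,2,0,1,3), (10,6,1,2,0), (10,0,5,1,1), (8,1,2,1,3), (17,0,2,1,1), (8,0,1,0,5),
     (14,5,0,2,0), (18,0,0,1,2), (7,3,1,0,4), (8,0,9,0,0), (10,2,2,0,3), (15,0,6,0,0),
     (11,4,5,0,0), (22,0,3,0,0), (18,4,2,0,0), (14,8,1,0,0), (9,3,2,2,1), (11,1,4,1,1),
     (17,0,2,0,2), (11,7,3,0,0), (22,3,1,0,0), (8,0,6,1,1), (8,5,1,1,2), (12,0,1,0,4),
     (13,8,0,1,0), (8,3,1,3,1), (11,10,1,0,0), (16,0,1,1,2), (10,7,2,1,0), (12,5,4,0,0),
     (11,1,1,2,2), (20,0,1,2,0), (11,7,0,1,1), (13,5,2,0,1), (10,4,1,2,1), (12,2,3,1,1),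
     (14,0,5,0,1), (12,8,2,0,0), (9,7,1,2,0), (8,5,1,0,3), (17,4,1,0,1), (7,2,2,1,3), (7,1,3,4,0),
     (22,0,0,0,2), (10,1,3,1,2), (10,2,7,0,0), (12,11,0,0,0), (13,0,4,1,1), (26,0,0,1,0),
     (7,0,5,1,2), (20,0,1,1,1), (8,1,4,2,1), (14,0,2,1,2), (14,1,6,0,0)] 774831908"
  by code_simp

lemma golay_sum_upto_6: "u \<le> 774831908 \<Longrightarrow> golay_sum 6 u"
  by (rule golay_sum_cover[OF covers_6, of 5]) (simp_all add: golay_sum_upto_5)

lemma covers_7: "covers 774831908 0
    [(11,0,5,2,0), (12,0,5,2,0), (11,1,5,2,0), (13,0,5,2,0), (11,0,6,2,0), (12,1,5,2,0),
     (12,7,1,2,0), (11,0,3,1,3), (8,2,3,1,3), (9,0,4,1,3), (8,0,3,2,3), (10,1,3,1,3), (8,0,3,1,4),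
     (12,0,6,0,2), (12,2,0,1,4), (10,3,5,1,1), (13,6,0,0,3), (11,6,1,1,2), (15,0,5,1,1),
     (19,5,0,2,0), (13,5,4,0,1), (15,1,6,1,0), (24,4,0,0,1), (17,2,6,0,0), (14,1,8,0,0),
     (15,1,6,0,1), (14,4,6,0,0), (17,8,2,0,0), (12,2,2,1,3), (15,2,7,0,0), (12,0,5,1,2),
     (23,2,2,0,1), (11,2,4,0,3), (10,4,0,1,4), (18,0,1,2,2), (22,8,0,0,0), (11,3,2,2,2),
     (10,1,7,2,0), (20,7,0,0,1), (23,6,1,0,0), (14,5,1,2,1), (14,4,0,1,3), (15,6,3,1,0),
     (13,8,4,0,0), (35,0,0,0,0), (14,1,2,0,4), (17,7,3,0,0), (11,0,4,0,4), (14,6,5,0,0),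
     (15,0,4,1,2), (15,6,3,0,1), (23,1,0,2,1), (14,9,3,0,0), (12,3,0,0,5), (11,0,1,1,5),
     (11,0,6,3,0), (15,7,1,2,0), (11,4,0,2,3), (17,4,2,0,2), (13,1,1,0,5), (17,2,2,2,1),
     (12,11,1,0,1), (17,2,5,0,1), (11,2,6,0,2), (11,0,1,0,6), (12,1,0,1,5), (23,5,2,0,0),
     (12,6,0,3,1), (24,0,5,0,0), (22,1,2,0,2), (14,4,5,0,1), (12,5,2,0,3), (19,0,4,0,2),
     (8,1,2,3,3), (13,5,0,0,4), (14,2,8,0,0), (16,4,1,0,3), (30,0,1,1,0), (19,3,2,0,2),
     (15,7,1,0,2), (10,2,2,2,3), (15,0,6,2,0), (11,4,5,2,0), (22,0,3,2,0), (15,4,0,1,3),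
     (13,1,6,0,2), (13,6,1,0,3), (18,4,5,0,0), (29,0,3,0,0), (13,4,1,2,2), (15,0,0,5,1),
     (18,7,0,2,0), (13,4,4,0,2), (22,3,4,0,0), (13,8,0,3,0), (15,6,2,2,0), (10,3,6,0,2),
     (19,2,6,0,0), (9,0,7,1,2), (22,0,3,1,1), (13,7,2,0,2), (22,6,2,0,0), (14,1,1,1,4),
     (23,0,1,1,2), (14,7,0,0,3), (14,6,1,3,0), (13,4,1,1,3), (13,5,5,0,1), (10,2,1,6,0),
     (12,2,6,1,1), (18,1,4,0,2), (15,0,3,2,2), (15,1,7,1,0), (21,0,5,0,1), (34,0,1,0,0),
     (15,0,6,0,2), (28,0,2,0,1), (12,0,9,1,0), (14,9,2,1,0), (20,8,0,0,1), (10,6,1,1,3),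
     (14,8,1,0,2), (11,7,0,2,2), (26,0,3,1,0), (14,1,6,2,0), (11,0,5,4,0), (24,2,4,0,0),
     (11,0,3,0,5), (15,0,0,3,3)] 96595246884"
  by code_simp

lemma golay_sum_upto_7: "u \<le> 96595246884 \<Longrightarrow> golay_sum 7 u"
  by (rule golay_sum_cover[OF covers_7, of 6]) (simp_all add: golay_sum_upto_6)

lemma covers_8: "covers 96595246884 0
    [(12,1,2,1,4), (13,1,2,1,4), (12,2,2,1,4), (14,1,2,1,4), (12,1,3,1,4), (13,2,2,1,4),
     (22,0,0,5,0), (22,2,0,2,2), (19,4,0,2,2), (20,2,1,2,2), (19,2,0,3,2), (21,3,0,2,2),
     (19,2,0,2,3), (16,1,5,0,3), (9,2,1,0,7), (13,1,0,0,7), (22,0,8,0,0), (10,3,0,0,7),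
     (15,0,8,1,1), (19,5,3,2,0), (13,5,7,0,1), (15,5,0,2,3), (20,3,7,0,0), (26,0,5,1,0),
     (11,5,0,0,6), (13,8,2,1,2), (11,0,1,7,1), (17,8,5,0,0), (19,3,3,2,1), (21,0,4,0,3),
     (12,0,8,1,2), (32,0,1,1,1), (11,0,4,4,2), (12,1,1,1,6), (12,6,1,3,2), (29,2,1,1,1),
     (17,9,3,1,0), (22,5,2,1,1), (18,3,5,0,2), (21,2,6,0,1), (28,0,0,4,0), (31,1,4,0,0),
     (13,0,5,5,0), (13,1,7,0,3), (18,4,6,0,1), (20,5,0,3,1), (17,0,6,0,3), (9,0,0,1,8),
     (12,6,1,1,4), (23,3,3,0,2), (14,9,3,2,0), (22,4,0,4,0), (17,2,8,1,0), (21,9,3,0,0),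
     (19,3,0,0,5), (9,0,2,4,4), (23,10,0,1,0), (12,6,1,0,5), (16,7,2,2,1), (12,4,1,2,4),
     (16,5,2,4,0), (12,4,4,0,4), (13,5,3,1,3), (14,6,2,2,2), (24,7,0,0,2), (16,8,0,4,0),
     (21,1,7,0,1), (19,0,1,4,2), (13,2,5,0,4), (11,3,2,0,6), (17,8,1,2,1), (17,2,5,1,2),
     (15,3,2,1,4), (14,7,3,2,1), (14,1,7,1,2), (26,4,0,3,0), (15,7,1,2,2), (22,2,3,2,1),
     (10,2,0,0,8), (25,1,4,2,0), (21,5,3,2,0), (17,9,2,2,0), (14,3,4,0,4), (19,1,8,0,1),
     (19,4,0,4,1), (26,1,5,0,1), (26,6,0,0,2), (15,3,7,2,0), (15,8,2,2,1), (26,4,0,2,1),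
     (15,3,10,0,0), (15,8,5,0,1), (15,13,0,0,2), (12,1,8,1,2), (19,7,1,2,1), (14,4,5,0,3),
     (23,3,5,0,1), (16,1,8,2,0), (13,6,1,1,4), (15,4,3,0,4), (24,3,3,0,2), (17,1,6,2,1),
     (15,9,3,2,0), (14,5,0,4,2), (23,6,3,0,1), (13,2,1,5,2), (15,2,6,0,3), (19,0,0,7,0),
     (21,0,5,2,1), (14,0,11,0,1), (18,6,2,0,3), (15,5,1,2,3), (14,3,1,0,6), (21,5,3,0,2),
     (10,0,0,0,9), (17,2,2,0,5), (24,4,4,0,1)] 11138100526884"
  by code_simp

lemma golay_sum_upto_8: "u \<le> 11138100526884 \<Longrightarrow> golay_sum 8 u"
  by (rule golay_sum_cover[OF covers_8, of 7]) (simp_all add: golay_sum_upto_7)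

section \<open>Greedy approximation of large numbers\<close>

text \<open>One octave suffices, since admissible values may be multiplied by powers of 2.\<close>

lemma refines_octave: "refines 407 (2 ^ 43)
    [(12,5,1,6,0), (9,0,2,1,7), (13,9,2,0,3), (15,6,0,0,5), (18,6,2,1,2), (13,2,2,0,6),
     (24,12,0,0,0), (37,0,1,0,1), (22,8,2,0,1), (18,7,6,0,0), (11,2,2,7,0), (18,0,6,0,3),
     (12,6,3,1,3), (14,3,1,1,5), (18,12,1,0,1), (31,0,2,0,2), (16,6,0,4,1), (14,4,5,0,3),
     (15,11,0,2,1), (15,0,9,1,1), (25,7,3,0,0), (19,13,0,1,0), (19,2,9,0,0), (19,6,0,1,3),
     (14,2,0,0,7), (10,1,4,0,6), (29,0,0,3,1), (23,8,0,0,2), (19,7,4,0,1), (12,2,0,7,1),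
     (13,2,10,0,1), (13,6,1,1,4), (17,15,1,0,0), (14,2,5,2,2), (15,9,0,4,0), (13,7,5,0,2),
     (15,4,3,0,4), (17,1,1,0,6), (13,0,5,0,5), (14,7,0,2,3), (26,7,1,0,1), (22,6,5,0,0),
     (15,1,1,7,0), (16,1,11,0,0), (16,5,2,1,3), (11,1,2,0,7), (22,11,0,0,1), (13,0,10,2,0),
     (22,4,0,0,4), (18,3,4,0,3), (14,2,8,0,2), (15,9,3,2,0), (17,6,1,2,2), (12,2,1,1,6),
     (16,11,1,0,2), (23,1,8,0,0), (17,7,5,1,0), (10,2,1,8,0), (17,0,5,1,3), (18,7,0,3,1),
     (23,6,3,0,1), (17,12,0,1,1), (17,1,9,0,1), (17,5,0,1,4), (21,14,0,0,0), (11,0,6,1,4),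
     (15,9,6,0,0), (17,6,4,0,2), (10,1,0,7,2), (18,2,8,1,0), (27,0,4,2,0), (21,6,1,3,0),
     (26,5,4,0,0), (19,0,0,7,0), (20,0,10,0,0), (14,6,7,1,0), (15,0,1,0,7), (17,10,0,3,0),
     (22,9,3,0,0), (16,15,0,1,0), (16,4,9,0,0), (16,8,0,1,3), (11,4,0,0,7), (14,4,2,1,4),
     (18,13,2,0,0), (15,0,6,2,2), (25,7,0,1,1), (14,5,6,0,2), (14,1,0,8,0), (15,1,10,1,0),
     (15,5,1,2,3), (10,1,1,1,7), (14,10,1,0,3), (21,0,8,0,1), (15,6,5,1,1), (17,3,3,1,3),
     (13,2,7,1,2), (23,9,1,0,1), (19,8,5,0,0), (12,3,1,7,0), (13,3,11,0,0), (13,7,2,1,3),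
     (15,4,0,1,5), (19,13,0,0,1), (16,0,4,2,3), (28,0,5,0,1), (22,6,2,1,1), (17,2,2,0,5),
     (11,0,2,8,0), (12,0,12,1,0), (12,4,3,2,3), (24,4,4,0,1), (18,10,1,1,1), (13,6,1,0,5),
     (16,6,3,1,2), (11,2,3,0,6), (21,1,0,6,0), (35,0,2,0,1), (20,6,0,4,0), (18,4,5,0,2),
     (19,11,0,2,0), (19,0,9,1,0), (13,6,6,2,0), (14,0,0,1,7), (18,9,0,0,3), (14,8,4,0,2),
     (16,5,2,0,4), (12,4,6,0,3), (12,0,0,8,1), (13,0,10,1,1), (23,7,4,0,0), (16,2,0,7,0),
     (17,2,10,0,0), (17,6,1,1,3), (12,2,1,0,7), (14,12,0,3,0), (14,1,9,2,0), (14,5,0,3,3),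
     (19,4,3,0,3), (13,10,0,1,3), (20,0,7,1,1), (14,6,4,2,1), (16,3,2,2,3), (12,2,6,2,2),
     (22,9,0,1,1), (17,5,0,0,5), (11,3,0,8,0), (11,0,6,0,5), (12,7,1,2,3), (24,7,2,0,1),
     (20,6,6,0,0), (13,1,2,7,0), (14,1,12,0,0), (14,5,3,1,3), (16,2,1,1,5), (20,11,1,0,1),
     (40,0,0,1,0), (18,7,3,0,2), (14,6,7,0,1), (23,2,0,5,0), (21,0,5,1,2), (15,6,2,2,2),
     (10,2,2,1,6), (14,11,2,0,2), (21,1,9,0,0), (15,7,6,1,0), (16,1,0,0,7), (12,0,4,0,6),
     (23,10,2,0,0), (25,7,0,0,2), (21,6,4,0,1), (14,1,0,7,1), (15,1,10,0,1), (15,5,1,1,4),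
     (19,14,1,0,0), (16,1,5,2,2), (17,8,0,4,0), (15,6,5,0,2), (16,13,0,2,0), (16,2,9,1,0),
     (16,6,0,2,3), (11,2,0,1,7), (15,11,0,0,3), (22,1,7,0,1), (16,7,4,1,1), (11,3,4,0,5),
     (30,2,0,3,0), (19,0,6,2,1), (13,6,3,3,1), (18,5,6,0,1), (11,0,2,7,1), (12,0,12,0,1),
     (12,4,3,1,4), (16,13,3,0,0), (13,0,7,2,2), (23,7,1,1,1), (18,3,1,0,5), (12,1,1,8,0),
     (13,1,11,1,0), (13,5,2,2,3), (25,5,3,0,1), (19,11,0,1,1), (19,0,9,0,1), (13,6,6,1,1),
     (23,13,0,0,0), (20,0,4,2,2), (14,6,1,3,2), (19,5,4,0,2), (12,0,0,7,2), (13,0,10,0,2),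
     (13,4,1,1,5), (17,13,1,0,1), (14,0,5,2,3), (15,7,0,4,1), (13,5,5,0,3), (14,12,0,2,1),
     (14,1,9,1,1), (24,8,3,0,0), (18,14,0,1,0), (18,3,9,0,0), (18,7,0,1,3), (13,3,0,0,7),
     (16,3,2,1,4), (20,12,2,0,0), (33,0,3,0,1), (27,6,0,1,1), (16,4,6,0,2), (16,0,0,8,0),
     (17,0,10,1,0), (17,4,1,2,3), (12,0,1,1,7), (16,9,1,0,3), (19,9,3,1,0), (14,5,3,0,4),
     (16,2,1,0,6), (10,0,1,8,1), (40,0,0,0,1), (25,8,1,0,1), (21,7,5,0,0), (14,2,1,7,0),
     (15,2,11,0,0), (15,6,2,1,3), (10,2,2,0,7), (21,12,0,0,1), (12,1,10,2,0), (21,5,0,0,4),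
     (17,4,4,0,3), (13,3,8,0,2), (14,10,3,2,0), (16,7,1,2,2), (11,3,1,1,6), (15,12,1,0,2),
     (22,2,8,0,0), (16,8,5,1,0), (18,5,3,1,2), (13,1,3,0,6), (23,0,0,6,0), (17,8,0,3,1),
     (22,7,3,0,1), (16,13,0,1,1), (16,2,9,0,1), (16,6,0,1,4), (20,15,0,0,0), (17,2,4,2,2),
     (13,1,8,2,1), (23,8,2,1,0), (18,4,2,0,4), (14,3,6,0,3), (15,10,1,2,1), (19,0,6,1,2),
     (13,6,3,2,2), (25,6,4,0,0), (18,1,0,7,0), (19,1,10,0,0), (19,5,1,1,3), (14,1,1,0,7),
     (16,11,0,3,0), (16,0,9,2,0), (16,4,0,3,3), (15,5,9,0,0), (15,9,0,1,3), (18,9,2,2,0),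
     (13,5,2,1,4), (17,14,2,0,0), (14,1,6,2,2), (24,8,0,1,1), (13,6,6,0,2), (13,2,0,8,0),
     (14,2,10,1,0), (14,6,1,2,3), (26,6,2,0,1), (22,5,6,0,0), (15,0,2,7,0), (16,0,12,0,0),
     (16,4,3,1,3), (11,0,3,0,7), (22,10,1,0,1), (18,9,5,0,0), (11,4,1,7,0), (18,2,5,0,3),
     (19,9,0,2,1), (14,5,0,1,5), (18,14,0,0,1), (15,1,4,2,3), (11,0,8,2,2), (21,7,2,1,1),
     (16,3,2,0,5), (10,1,2,8,0), (24,0,4,2,1), (18,6,1,3,1), (23,5,4,0,1), (16,0,0,7,1),
     (17,0,10,0,1), (17,4,1,1,4), (21,13,1,0,0), (18,0,5,2,2), (12,6,2,3,2), (17,5,5,0,2),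
     (10,0,1,7,2), (18,1,9,1,0), (18,5,0,2,3), (13,1,0,1,7), (17,10,0,0,3), (24,0,7,0,1),
     (18,6,4,1,1), (11,1,0,8,1), (12,1,10,1,1), (22,8,4,0,0), (15,3,0,7,0), (16,3,10,0,0),
     (16,7,1,1,3), (11,3,1,0,7), (14,3,3,1,4), (18,12,3,0,0), (31,0,4,0,1), (25,6,1,1,1),
     (14,4,7,0,2), (23,0,0,5,1), (44,0,0,0,0)] (2 ^ 44)"
  by code_simp

text \<open>Division by a power of 2 moves \<open>u\<close> into the octave from
  \<open>2 ^ 43\<close> to \<open>2 ^ 44\<close>, and the length found there is multiplied back. 407
  is the least integer whose cube reaches \<open>2 ^ 26\<close>.\<close>

lemma golay_length_close_below:
  assumes "2 ^ 43 \<le> u"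
  shows "\<exists>g. golay_length g \<and> g \<le> u \<and> 407 * (u - g) \<le> g"
proof -
  define q where "q j = u div 2 ^ j" for j :: nat
  have "u < 2 ^ (44 + u)"
    by (rule less_le_trans[OF less_exp]) (intro power_increasing, simp_all)
  then obtain j where j: "u < 2 ^ (44 + j)" and least: "\<And>i. i < j \<Longrightarrow> \<not> u < 2 ^ (44 + i)"
    using exists_least_iff[of "\<lambda>j. u < 2 ^ (44 + j)"] by blast
  have "2 ^ (43 + j) \<le> u"
  proof (cases j)
    case 0
    then show ?thesis using assms by simp
  next
    case (Suc i)
    then show ?thesis using least[of i] by simp
  qed
  then have q: "2 ^ 43 \<le> q j" "q j < 2 ^ 44"
    using j by (simp_all add: q_def power_add less_eq_div_iff_mult_less_eq div_less_iff_less_mult)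
  have "golay_length (nat (2 ^ 43))"
    using golay_length_2_power_mult[OF golay_length_1, of 43] by simp
  then obtain g where g: "golay_length g" "g \<le> q j" "407 * (int (q j) + 1 - int g) \<le> int g"
    using refinesD[OF refines_octave, of "q j"] q by auto
  have le: "2 ^ j * g \<le> u"
  proof -
    have "2 ^ j * g \<le> 2 ^ j * q j" using g(2) by simp
    also have "\<dots> \<le> u" by (simp add: q_def)
    finally show ?thesis .
  qed
  \<comment> \<open>Rounding down to \<open>q j\<close> loses less than one unit of size
    \<open>2 ^ j\<close>, which the bound for \<open>q j + 1\<close> absorbs.\<close>
  have lt: "u < 2 ^ j * (q j + 1)"
    using dividend_less_times_div[of "2 ^ j" u] by (simp add: q_def)
  have "int (q j + 1 - g) = int (q j) + 1 - int g"
    using g(2) by (simp add: of_nat_diff)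
  then have "int (407 * (q j + 1 - g)) \<le> int g"
    using g(3) by (simp only: of_nat_mult of_nat_numeral)
  then have "407 * (q j + 1 - g) \<le> g"
    by (simp only: of_nat_le_iff)
  then have "2 ^ j * (407 * (q j + 1 - g)) \<le> 2 ^ j * g"
    by simp
  moreover have "u - 2 ^ j * g \<le> 2 ^ j * (q j + 1 - g)"
    using lt by (simp add: diff_mult_distrib2)
  ultimately have "407 * (u - 2 ^ j * g) \<le> 2 ^ j * g"
    by linarith
  then show ?thesis
    using le golay_length_2_power_mult[OF g(1)] by blast
qed

text \<open>Take logarithms and divide by 26. The integer hypothesis can be computed for concrete
  numbers.\<close>

lemma log_bound_of_power:
  assumes "2 ^ (26 * j) \<le> u ^ 3" "0 < u"
  shows "real j \<le> 3 / 26 * log 2 (real u)"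
proof -
  have "real (2 ^ (26 * j)) \<le> real (u ^ 3)"
    using assms(1) by (simp only: of_nat_le_iff)
  then have "log 2 (2 ^ (26 * j)) \<le> log 2 (real u ^ 3)"
    using assms(2) by (intro log_mono) auto
  then show ?thesis
    using assms(2) by (simp add: log_nat_power)
qed

text \<open>Up to 71908 the constant 4 suffices; each further table costs one summand, paid for by
  the lower end of its range. The last table ends above \<open>2 ^ 43\<close>, and from there strong
  induction removes one close Golay length at a time.\<close>

lemma golay_sum_log:
  assumes "0 < u"
  shows "\<exists>l. golay_sum l u \<and> real l \<le> 3 / 26 * log 2 (real u) + 4"
  using assms
proof (induction u rule: less_induct)
  case (less u)
  have log0: "0 \<le> log 2 (real u)" using less.prems by simp
  have bound: ?case if "golay_sum (4 + j) u" "2 ^ (26 * j) \<le> u ^ 3" for j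
    using that(1) log_bound_of_power[OF that(2) less.prems] by (intro exI[of _ "4 + j"]) auto
  have cube: "c ^ 3 \<le> u ^ 3" if "c \<le> u" for c
    using that by (intro power_mono) auto
  consider "u \<le> 71908" | "71908 < u" "u \<le> 6831908" | "6831908 < u" "u \<le> 774831908"
    | "774831908 < u" "u \<le> 96595246884" | "96595246884 < u" "u \<le> 11138100526884" | "11138100526884 < u"
    by linarith
  then show ?case
  proof cases
    case 1
    then show ?thesis using golay_sum_upto_4[of u] less.prems by (intro bound[of 0]) auto
  next
    case 2
    then show ?thesis
      using golay_sum_upto_5[of u] cube[of 71908] by (intro bound[of 1]) auto
  next
    case 3
    then show ?thesis
      using golay_sum_upto_6[of u] cube[of 6831908] by (intro bound[of 2]) auto
  next
    case 4
    then show ?thesis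
      using golay_sum_upto_7[of u] cube[of 774831908] by (intro bound[of 3]) auto
  next
    case 5
    then show ?thesis
      using golay_sum_upto_8[of u] cube[of 96595246884] by (intro bound[of 4]) auto
  next
    case 6
    then obtain g where g: "golay_length g" "g \<le> u" "407 * (u - g) \<le> g"
      using golay_length_close_below[of u] by auto
    have "0 < g" using g(1) by (simp add: golay_length_def)
    show ?thesis
    proof (cases "u = g")
      case True
      then have "golay_sum 1 u"
        using golay_sum_Suc[OF g(1,2), of 0] by (simp add: golay_sum_0)
      then show ?thesis using log0 by (intro exI[of _ 1]) auto
    next
      case False
      then have pos: "0 < u - g" and lt: "u - g < u"
        using g(2) \<open>0 < g\<close> by auto
      obtain l where l: "golay_sum l (u - g)" "real l \<le> 3 / 26 * log 2 (real (u - g)) + 4"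
        using less.IH[OF lt pos] by blast
      have "407 * (u - g) \<le> u" using g(2,3) by simp
      then have "log 2 (real (407 * (u - g))) \<le> log 2 (real u)"
        using pos by (intro log_mono) auto
      moreover have "log 2 (real (407 * (u - g))) = log 2 407 + log 2 (real (u - g))"
        unfolding of_nat_mult using pos by (subst log_mult) simp_all
      \<comment> \<open>The remainder is at most \<open>u / 407\<close>, so its logarithmic bound is
        lower by at least the 1 spent on \<open>g\<close>.\<close>
      moreover have "1 \<le> 3 / 26 * log 2 407"
        using log_bound_of_power[of 1 407] by simp
      ultimately have "real (Suc l) \<le> 3 / 26 * log 2 (real u) + 4"
        using l(2) by simp
      then show ?thesis
        using golay_sum_Suc[OF g(1,2) l(1)] by blast
    qed
  qed
qed

section \<open>Anticommuting Hermitian matrices from Golay pairs\<close>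

text \<open>A block \<open>(i, m, a, b)\<close> is a Golay pair of length \<open>m\<close> carrying the variable \<open>i\<close>. The last
  block of a list occupies the lowest positions. Rows and columns are lists with two bits per block:
  the first selects the half of \<open>[[0, W], [W*, 0]]\<close>, the second the row of \<open>W\<close> or \<open>W*\<close>.\<close>

type_synonym block = "nat \<times> nat \<times> (nat \<Rightarrow> complex) \<times> (nat \<Rightarrow> complex)"

fun blocks_length :: "block list \<Rightarrow> nat" where
  "blocks_length [] = 0"
| "blocks_length ((i, m, a, b) # B) = m + blocks_length B"

fun block_var :: "block list \<Rightarrow> nat \<Rightarrow> nat" where
  "block_var [] p = 0"
| "block_var ((i, m, a, b) # B) p = (if p < blocks_length B then block_var B p else i)"

text \<open>In row \<open>r\<close>, position \<open>p\<close> or its mirror image (\<open>s\<close>) and \<open>chi\<close>-degree \<open>d\<close>, the only nonzero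
  coefficient stands in column \<open>hit B p d r\<close> and equals \<open>unit_entry B p s d r\<close> times a variable.\<close>

fun hit :: "block list \<Rightarrow> nat \<Rightarrow> bool \<Rightarrow> bool list \<Rightarrow> bool list" where
  "hit ((i, m, a, b) # B) p d (al # be # r) =
     (if p < blocks_length B then al # be # hit B p d r else (\<not> al) # (be \<noteq> d) # r)"
| "hit _ _ _ r = r"

fun unit_entry :: "block list \<Rightarrow> nat \<Rightarrow> bool \<Rightarrow> bool \<Rightarrow> bool list \<Rightarrow> complex" where
  "unit_entry ((i, m, a, b) # B) p s d (al # be # r) =
     (if p < blocks_length B then (if al then -1 else 1) * unit_entry B p s d r
      else if s then
        (if al then (if be then cnj (b (p - blocks_length B)) else cnj (a (p - blocks_length B)))
         else (if d then -1 else 1) * (if be = d then cnj (b (p - blocks_length B)) else cnj (a (p - blocks_length B))))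
      else
        (if al then (if d then -1 else 1) * (if be then a (p - blocks_length B) else b (p - blocks_length B))
         else (if be = d then a (p - blocks_length B) else b (p - blocks_length B))))"
| "unit_entry _ _ _ _ _ = 1"

definition sgnb :: "bool \<Rightarrow> complex" where "sgnb d = (if d then -1 else 1)"

text \<open>With \<open>A\<close> and \<open>B\<close> the shifted values of the pair, this is the
  entry of W (\<open>al\<close> false) or of its adjoint (\<open>al\<close> true) in row
  \<open>be\<close> and column \<open>be \<noteq> d\<close>, with the factor \<chi> for
  \<open>d\<close> true left out.\<close>

definition block_entry :: "complex \<Rightarrow> complex \<Rightarrow> bool \<Rightarrow> bool \<Rightarrow> bool \<Rightarrow> complex" where
  "block_entry A B al be d =
     (if al then sgnb d * (if be then A else B) + (if be then cnj B else cnj A)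
      else (if be = d then A else B) + sgnb d * (if be = d then cnj B else cnj A))"

text \<open>The first summand is diag(1, -1) on the bit \<open>al\<close> tensored with the matrix
  of the remaining blocks; the second is off-diagonal in \<open>al\<close> and the identity on the
  remaining bits. This is the Jordan-Wigner sign that makes different blocks anticommute. Odd powers
  of \<eta> encode half-integer positions.\<close>

fun symbol_matrix ::
  "block list \<Rightarrow> (nat \<Rightarrow> real) \<Rightarrow> complex \<Rightarrow> complex \<Rightarrow> bool list \<Rightarrow> bool list \<Rightarrow> complex" where
  "symbol_matrix ((i, m, a, b) # B) x \<eta> \<chi> (al # be # r) (al' # be' # c) =
     (if al' = al \<and> be' = be then sgnb al * symbol_matrix B x \<eta> \<chi> r c else 0) +
     (if al' = (\<not> al) \<and> c = r
      then of_real (x i) * (if be \<noteq> be' then \<chi> else 1) *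
        block_entry (\<eta> ^ (2 * blocks_length B + 1) * seq_eval m a (\<eta>\<^sup>2))
          (\<eta> ^ (2 * blocks_length B + 1) * seq_eval m b (\<eta>\<^sup>2)) al be (be \<noteq> be')
      else 0)"
| "symbol_matrix _ _ _ _ _ _ = 0"

section \<open>Hermitian symmetry and orthogonality of the symbol matrix\<close>

lemma lists_length_Suc:
  "{xs :: bool list. length xs = Suc n} = (\<lambda>(b, xs). b # xs) ` (UNIV \<times> {xs. length xs = n})"
  by (force simp: length_Suc_conv)

lemma finite_bool_lists [simp]: "finite {xs :: bool list. length xs = n}"
  using finite_lists_length_eq[of "UNIV :: bool set" n] by simp

lemma sum_bool_lists_Suc:
  "(\<Sum>xs | length xs = Suc n. f xs) = (\<Sum>xs | length xs = n. f (False # xs) + f (True # xs))"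
proof -
  have "(\<Sum>xs | length xs = Suc n. f xs) =
      (\<Sum>p\<in>UNIV \<times> {xs :: bool list. length xs = n}. f (fst p # snd p))"
    unfolding lists_length_Suc by (subst sum.reindex) (auto simp: inj_on_def case_prod_unfold)
  also have "\<dots> = (\<Sum>b\<in>UNIV. \<Sum>xs | length xs = n. f (b # xs))"
    by (simp add: sum.cartesian_product case_prod_unfold)
  finally show ?thesis
    by (simp add: UNIV_bool sum.distrib add.commute)
qed

text \<open>The transposed position has row \<open>be \<noteq> d\<close> and column
  \<open>be\<close>, hence the same \<open>d\<close>, and the two off-diagonal blocks are adjoint to
  each other.\<close>

lemma block_entry_hermitian:
  "cnj (block_entry A B (\<not> al) (be \<noteq> d) d) = block_entry A B al be d"
  by (cases al; cases be; cases d) (auto simp: block_entry_def sgnb_def)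

lemma symbol_matrix_hermitian:
  assumes "length r = 2 * length B" "length c = 2 * length B" "cnj \<chi> = \<chi>"
  shows "cnj (symbol_matrix B x \<eta> \<chi> c r) = symbol_matrix B x \<eta> \<chi> r c"
  using assms
proof (induction B arbitrary: r c)
  case Nil
  then show ?case by simp
next
  case (Cons blk B)
  obtain i m a b where blk: "blk = (i, m, a, b)" by (cases blk)
  obtain al be r0 where r: "r = al # be # r0" "length r0 = 2 * length B"
    using Cons.prems(1) by (auto simp: length_Suc_conv)
  obtain al' be' c0 where c: "c = al' # be' # c0" "length c0 = 2 * length B"
    using Cons.prems(2) by (auto simp: length_Suc_conv)
  note IH = Cons.IH[OF r(2) c(2) Cons.prems(3)]
  let ?A = "\<eta> ^ (2 * blocks_length B + 1) * seq_eval m a (\<eta>\<^sup>2)"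
  let ?B = "\<eta> ^ (2 * blocks_length B + 1) * seq_eval m b (\<eta>\<^sup>2)"
  have N: "cnj (block_entry ?A ?B al' be' (be' \<noteq> be)) = block_entry ?A ?B al be (be \<noteq> be')"
    if "al' = (\<not> al)"
    using block_entry_hermitian[of ?A ?B al be "be \<noteq> be'"] that
    by (cases be; cases be') simp_all
  show ?case
    unfolding blk r(1) c(1) symbol_matrix.simps complex_cnj_add
  proof (rule arg_cong2[of _ _ _ _ "(+)"])
    show "cnj (if al = al' \<and> be = be' then sgnb al' * symbol_matrix B x \<eta> \<chi> c0 r0 else 0) =
      (if al' = al \<and> be' = be then sgnb al * symbol_matrix B x \<eta> \<chi> r0 c0 else 0)"
      using IH by (auto simp: sgnb_def)
  next
    show "cnj (if al = (\<not> al') \<and> r0 = c0 then of_real (x i) * (if be' \<noteq> be then \<chi> else 1) *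
        block_entry ?A ?B al' be' (be' \<noteq> be) else 0) =
      (if al' = (\<not> al) \<and> c0 = r0 then of_real (x i) * (if be \<noteq> be' then \<chi> else 1) *
        block_entry ?A ?B al be (be \<noteq> be') else 0)"
      using N Cons.prems(3) by auto
  qed
qed

text \<open>Both W and its adjoint have orthogonal rows: the products of \<open>A\<close> with
  \<open>B\<close> from the two columns cancel by commutativity, and each row keeps the norm
  \<open>2 * t\<close>.\<close>

lemma block_entry_orthogonal:
  fixes A B \<chi> :: complex
  assumes "A * cnj A + B * cnj B = t" "cnj \<chi> = \<chi>" "\<chi> * \<chi> = 1"
  shows "(\<Sum>be'\<in>UNIV. (if be \<noteq> be' then \<chi> else 1) * block_entry A B al be (be \<noteq> be') *
           cnj ((if be1 \<noteq> be' then \<chi> else 1) * block_entry A B al be1 (be1 \<noteq> be'))) =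
         (if be = be1 then 2 * t else 0)"
proof -
  have \<chi>2: "\<chi> * (\<chi> * z) = z" for z
    using assms(3) by (simp flip: mult.assoc)
  show ?thesis
    unfolding assms(1)[symmetric]
    by (cases al; cases be; cases be1)
      (simp_all add: block_entry_def sgnb_def UNIV_bool assms(2,3) \<chi>2 algebra_simps)
qed

fun blocks_norm :: "block list \<Rightarrow> (nat \<Rightarrow> real) \<Rightarrow> real" where
  "blocks_norm [] x = 0"
| "blocks_norm ((i, m, a, b) # B) x = real m * (x i)\<^sup>2 + blocks_norm B x"

definition golay_blocks :: "block list \<Rightarrow> bool" where
  "golay_blocks B \<longleftrightarrow> (\<forall>(i, m, a, b) \<in> set B. golay_pair m a b)"

lemma golay_pair_shifted:
  assumes "golay_pair m a b" and \<eta>: "\<eta> * cnj \<eta> = 1"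
  shows "(\<eta> ^ n * seq_eval m a (\<eta>\<^sup>2)) * cnj (\<eta> ^ n * seq_eval m a (\<eta>\<^sup>2)) +
         (\<eta> ^ n * seq_eval m b (\<eta>\<^sup>2)) * cnj (\<eta> ^ n * seq_eval m b (\<eta>\<^sup>2)) = of_nat (2 * m)"
    (is "?l = _")
proof -
  let ?A = "seq_eval m a (\<eta>\<^sup>2)" and ?B = "seq_eval m b (\<eta>\<^sup>2)"
  have "?l = (\<eta> ^ n * cnj (\<eta> ^ n)) * (?A * cnj ?A + ?B * cnj ?B)"
    by (simp add: algebra_simps)
  also have "?A * cnj ?A + ?B * cnj ?B = of_nat (2 * m)"
    using assms unit_power[OF \<eta>, of 2] unfolding golay_pair_def by blast
  finally show ?thesis by (simp only: unit_power[OF \<eta>] mult_1)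
qed

text \<open>The part of the head block anticommutes with the signed part of the remaining blocks, so
  only the squares survive and the norms add up.\<close>

lemma symbol_matrix_orthogonal:
  assumes "golay_blocks B" "length r = 2 * length B" "length r' = 2 * length B"
    and \<eta>: "\<eta> * cnj \<eta> = 1" and \<chi>: "cnj \<chi> = \<chi>" "\<chi> * \<chi> = 1"
  shows "(\<Sum>c | length c = 2 * length B. symbol_matrix B x \<eta> \<chi> r c * cnj (symbol_matrix B x \<eta> \<chi> r' c)) =
         (if r = r' then of_real (4 * blocks_norm B x) else 0)"
  using assms(1-3)
proof (induction B arbitrary: r r')
  case Nil
  then show ?case by simp
next
  case (Cons blk B)
  obtain i m a b where blk: "blk = (i, m, a, b)" by (cases blk)
  obtain al be r0 where r: "r = al # be # r0" "length r0 = 2 * length B"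
    using Cons.prems(2) by (auto simp: length_Suc_conv)
  obtain al1 be1 r1 where r': "r' = al1 # be1 # r1" "length r1 = 2 * length B"
    using Cons.prems(3) by (auto simp: length_Suc_conv)
  have gB: "golay_blocks B" and gp: "golay_pair m a b"
    using Cons.prems(1) by (auto simp: golay_blocks_def blk)
  note IH = Cons.IH[OF gB r(2) r'(2)]
  define A' where "A' = \<eta> ^ (2 * blocks_length B + 1) * seq_eval m a (\<eta>\<^sup>2)"
  define B' where "B' = \<eta> ^ (2 * blocks_length B + 1) * seq_eval m b (\<eta>\<^sup>2)"
  define S where "S = symbol_matrix B x \<eta> \<chi>"
  define N where "N al be be' = (if be \<noteq> be' then \<chi> else 1) * block_entry A' B' al be (be \<noteq> be')"
    for al be be'
  have AB: "A' * cnj A' + B' * cnj B' = of_nat (2 * m)"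
    unfolding A'_def B'_def by (rule golay_pair_shifted[OF gp \<eta>])
  have step: "symbol_matrix (blk # B) x \<eta> \<chi> (al # be # r) (al' # be' # c) =
      (if al' = al \<and> be' = be then sgnb al * S r c else 0) +
      (if al' = (\<not> al) \<and> c = r then of_real (x i) * N al be be' else 0)" for al be r al' be' c
    unfolding blk symbol_matrix.simps S_def N_def A'_def B'_def by (simp only: mult.assoc)
  have Nherm: "cnj (N (\<not> al) be' be) = N al be be'" for al be be'
    using block_entry_hermitian[of A' B' al be "be \<noteq> be'"] \<chi>(1)
    by (cases be; cases be') (auto simp: N_def)
  have Sherm: "cnj (S r1 r0) = S r0 r1"
    unfolding S_def by (rule symbol_matrix_hermitian[OF r(2) r'(2) \<chi>(1)])
  have Northo: "N al be True * cnj (N al be1 True) + N al be False * cnj (N al be1 False) =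
      (if be = be1 then 4 * of_nat m else 0)" for al be be1
    using block_entry_orthogonal[OF AB \<chi>, of be al be1] by (simp add: N_def UNIV_bool algebra_simps)
  have fin: "finite {c :: bool list. length c = 2 * length B}" by simp
  have len: "2 * length (blk # B) = Suc (Suc (2 * length B))" by simp
  show ?case
  proof (cases "al = al1")
    \<comment> \<open>For equal first bits the signed part of one row and the off-diagonal part of
      the other meet no common column; only the two squares contribute.\<close>
    case True
    have "(\<Sum>c | length c = 2 * length (blk # B).
            symbol_matrix (blk # B) x \<eta> \<chi> r c * cnj (symbol_matrix (blk # B) x \<eta> \<chi> r' c)) =
        (\<Sum>c | length c = 2 * length B. (if be = be1 then S r0 c * cnj (S r1 c) else 0) +
           (if c = r0 then (if r0 = r1 then of_real ((x i)\<^sup>2) *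
              (N al be True * cnj (N al be1 True) + N al be False * cnj (N al be1 False)) else 0) else 0))"
      unfolding len sum_bool_lists_Suc r r' step
      by (intro sum.cong refl, cases al; cases be; cases be1; insert True)
         (auto simp: sgnb_def algebra_simps power2_eq_square)
    also have "\<dots> = (if be = be1 then \<Sum>c | length c = 2 * length B. S r0 c * cnj (S r1 c) else 0) +
        (if r0 = r1 then of_real ((x i)\<^sup>2) * (if be = be1 then 4 * of_nat m else 0) else 0)"
      unfolding sum.distrib Northo by (simp add: sum.delta[OF fin] r(2) r'(2) del: of_real_power)
    also have "\<dots> = (if r = r' then of_real (4 * blocks_norm (blk # B) x) else 0)"
      using IH True unfolding S_def r r' blk by (auto simp: algebra_simps)
    finally show ?thesis .
  next
    \<comment> \<open>For different first bits only the mixed products remain, one at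
      \<open>c = r1\<close> and one at \<open>c = r0\<close>.\<close>
    case False
    have "(\<Sum>c | length c = 2 * length (blk # B).
            symbol_matrix (blk # B) x \<eta> \<chi> r c * cnj (symbol_matrix (blk # B) x \<eta> \<chi> r' c)) =
        (\<Sum>c | length c = 2 * length B.
           (if c = r1 then sgnb al * S r0 r1 * of_real (x i) * cnj (N (\<not> al) be1 be) else 0) +
           (if c = r0 then of_real (x i) * N al be be1 * sgnb (\<not> al) * cnj (S r1 r0) else 0))"
      unfolding len sum_bool_lists_Suc r r' step
      by (intro sum.cong refl, cases al; cases be; cases be1; insert False)
         (auto simp: sgnb_def algebra_simps)
    also have "\<dots> = sgnb al * S r0 r1 * of_real (x i) * cnj (N (\<not> al) be1 be) +
        of_real (x i) * N al be be1 * sgnb (\<not> al) * cnj (S r1 r0)"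
      unfolding sum.distrib by (simp add: sum.delta[OF fin] r(2) r'(2))
    \<comment> \<open>By Hermitian symmetry the two mixed products agree except for the signs of
      \<open>al\<close> and its negation, which are opposite.\<close>
    also have "\<dots> = 0"
      unfolding Nherm Sherm by (simp add: sgnb_def)
    finally show ?thesis using False by (simp add: r r')
  qed
qed

section \<open>Expansion by position and degree\<close>

text \<open>Position \<open>p\<close> is the half-integer \<open>p + 1/2\<close>, so that no position is its own mirror image;
  \<open>\<eta>\<close> is a square root of the root of unity.\<close>

definition symbol_term ::
  "block list \<Rightarrow> (nat \<Rightarrow> real) \<Rightarrow> complex \<Rightarrow> complex \<Rightarrow> bool list \<Rightarrow> bool list \<Rightarrow> nat \<Rightarrow> bool \<Rightarrow> complex" where
  "symbol_term B x \<eta> \<chi> r c p d = (if hit B p d r = c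
     then of_real (x (block_var B p)) * (if d then \<chi> else 1) *
       (unit_entry B p False d r * \<eta> ^ (2 * p + 1) + unit_entry B p True d r * cnj (\<eta> ^ (2 * p + 1)))
     else 0)"

text \<open>Passes from polynomial values to monomials with a known column and a unit coefficient.
  Positions below the length of the remaining blocks come from the signed part of the recursion, the
  others from the head block.\<close>

lemma symbol_matrix_eq_sum:
  assumes "length r = 2 * length B" "length c = 2 * length B"
  shows "symbol_matrix B x \<eta> \<chi> r c =
    (\<Sum>p<blocks_length B. symbol_term B x \<eta> \<chi> r c p False + symbol_term B x \<eta> \<chi> r c p True)"
  using assms
proof (induction B arbitrary: r c)
  case Nil
  then show ?case by simp
next
  case (Cons blk B)
  obtain i m a b where blk: "blk = (i, m, a, b)" by (cases blk)
  obtain al be r0 where r: "r = al # be # r0" "length r0 = 2 * length B"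
    using Cons.prems(1) by (auto simp: length_Suc_conv)
  obtain al' be' c0 where c: "c = al' # be' # c0" "length c0 = 2 * length B"
    using Cons.prems(2) by (auto simp: length_Suc_conv)
  define n where "n = blocks_length B"
  have sh: "\<eta> ^ (2 * n + 1) * seq_eval m a (\<eta>\<^sup>2) = (\<Sum>q<m. a q * \<eta> ^ (2 * (n + q) + 1))" for a
    unfolding seq_eval_def sum_distrib_left
    unfolding power_mult[symmetric]
    by (intro sum.cong refl) (simp add: distrib_left power_add mult_ac)
  have old: "(\<Sum>p<n. symbol_term (blk # B) x \<eta> \<chi> r c p False + symbol_term (blk # B) x \<eta> \<chi> r c p True) =
      (if al' = al \<and> be' = be then sgnb al * symbol_matrix B x \<eta> \<chi> r0 c0 else 0)"
    unfolding Cons.IH[OF r(2) c(2)] sum_distrib_left n_def[symmetric]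
    by (cases "al' = al \<and> be' = be")
       (auto simp: symbol_term_def blk r c n_def sgnb_def algebra_simps
          intro!: sum.cong sum.neutral)
  have new: "(\<Sum>q<m. symbol_term (blk # B) x \<eta> \<chi> r c (n + q) False + symbol_term (blk # B) x \<eta> \<chi> r c (n + q) True) =
     (if al' = (\<not> al) \<and> c0 = r0
      then of_real (x i) * (if be \<noteq> be' then \<chi> else 1) *
        block_entry (\<eta> ^ (2 * n + 1) * seq_eval m a (\<eta>\<^sup>2))
          (\<eta> ^ (2 * n + 1) * seq_eval m b (\<eta>\<^sup>2)) al be (be \<noteq> be')
      else 0)"
    unfolding sh
    by (cases al; cases be; cases be'; cases "al' = (\<not> al) \<and> c0 = r0")
       (auto simp: symbol_term_def blk r c n_def sgnb_def block_entry_def algebra_simps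
          sum.distrib sum_distrib_left sum_subtractf sum_negf)
  show ?case
    unfolding blk blocks_length.simps sum_lessThan_add
    using old new unfolding blk n_def r(1) c(1) by simp
qed

section \<open>Development over the cyclic group\<close>

lemma cis_root_power_inj:
  assumes "M > 0" "g < M" "g' < M" "cis (2 * pi / real M) ^ g = cis (2 * pi / real M) ^ g'"
  shows "g = g'"
proof -
  have "inj_on (\<lambda>k. cis (2 * pi * real k / real M)) {..<M}"
    using bij_betw_roots_unity[OF assms(1)] by (rule bij_betw_imp_inj_on)
  moreover have "cis (2 * pi * real k / real M) = cis (2 * pi / real M) ^ k" for k
    by (simp add: Complex.DeMoivre field_simps)
  ultimately show ?thesis
    using assms by (auto simp: inj_on_def)
qed

lemma sum_powers_of_root_of_unity:
  fixes z :: complex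
  assumes "z ^ M = 1"
  shows "(\<Sum>t<M. z ^ t) = (if z = 1 then of_nat M else 0)"
  using assms by (simp add: sum_gp_strict)

lemma dft_orthogonality:
  assumes "M > 0" "g < M" "g' < M"
  defines "w \<equiv> cis (2 * pi / real M)"
  shows "(\<Sum>t<M. (w ^ t) ^ g * cnj ((w ^ t) ^ g')) = (if g = g' then of_nat M else 0)"
proof -
  define z where "z = w ^ g * cnj (w ^ g')"
  have ww: "w * cnj w = 1"
    by (simp add: w_def flip: complex_norm_square)
  have wM: "w ^ M = 1"
    using assms(1) by (simp add: w_def Complex.DeMoivre)
  have "z ^ M = (w ^ M) ^ g * cnj ((w ^ M) ^ g')"
    by (simp add: z_def power_mult_distrib mult.commute flip: power_mult)
  then have zM: "z ^ M = 1"
    by (simp add: wM)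
  have z1: "z = 1 \<longleftrightarrow> g = g'"
  proof
    assume "z = 1"
    then have "w ^ g' = (w ^ g * cnj (w ^ g')) * w ^ g'"
      by (simp add: z_def)
    also have "\<dots> = w ^ g * (w ^ g' * cnj (w ^ g'))"
      by (simp only: mult_ac)
    also have "\<dots> = w ^ g"
      by (simp only: unit_power[OF ww] mult_1_right)
    finally show "g = g'"
      using cis_root_power_inj[OF assms(1-3)] unfolding w_def by metis
  next
    assume "g = g'"
    then show "z = 1"
      unfolding z_def by (simp only: unit_power[OF ww])
  qed
  have "(\<Sum>t<M. (w ^ t) ^ g * cnj ((w ^ t) ^ g')) = (\<Sum>t<M. z ^ t)"
    by (intro sum.cong refl) (simp add: z_def power_mult_distrib mult.commute flip: power_mult)
  then show ?thesis
    using sum_powers_of_root_of_unity[OF zM] z1 by simp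
qed

text \<open>Moves inner products of coefficients to the characters of the cyclic group, where shifts
  act as scalars.\<close>

lemma parseval:
  assumes "M > 0"
  defines "w \<equiv> cis (2 * pi / real M)"
  shows "of_nat M * (\<Sum>h<M. f h * cnj (f' h)) =
    (\<Sum>t<M. (\<Sum>h<M. f h * (w ^ t) ^ h) * cnj (\<Sum>h<M. f' h * (w ^ t) ^ h))"
proof -
  have "(\<Sum>t<M. (\<Sum>h<M. f h * (w ^ t) ^ h) * cnj (\<Sum>h<M. f' h * (w ^ t) ^ h)) =
      (\<Sum>t<M. \<Sum>h<M. \<Sum>h'<M. f h * cnj (f' h') * ((w ^ t) ^ h * cnj ((w ^ t) ^ h')))"
    unfolding cnj_sum sum_product by (intro sum.cong refl) (simp add: mult_ac)
  also have "\<dots> = (\<Sum>h<M. \<Sum>h'<M. \<Sum>t<M. f h * cnj (f' h') * ((w ^ t) ^ h * cnj ((w ^ t) ^ h')))"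
    by (subst sum.swap) (intro sum.cong refl sum.swap)
  also have "\<dots> = (\<Sum>h<M. \<Sum>h'<M. if h = h' then of_nat M * (f h * cnj (f' h)) else 0)"
    unfolding sum_distrib_left[symmetric]
  proof (intro sum.cong refl)
    fix h h' assume "h \<in> {..<M}" "h' \<in> {..<M}"
    then have d: "(\<Sum>t<M. (w ^ t) ^ h * cnj ((w ^ t) ^ h')) = (if h = h' then of_nat M else 0)"
      unfolding w_def by (intro dft_orthogonality[OF assms(1)]) simp_all
    show "f h * cnj (f' h') * (\<Sum>t<M. (w ^ t) ^ h * cnj ((w ^ t) ^ h')) =
        (if h = h' then of_nat M * (f h * cnj (f' h)) else 0)"
      unfolding d by simp
  qed
  also have "\<dots> = of_nat M * (\<Sum>h<M. f h * cnj (f' h))"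
    by (simp add: sum_distrib_left)
  finally show ?thesis ..
qed

text \<open>The difference \<open>h - g\<close> modulo \<open>M\<close>; for \<open>g < M\<close>
  the form \<open>M - g\<close> avoids truncated subtraction.\<close>

definition offset :: "nat \<Rightarrow> nat \<Rightarrow> nat \<Rightarrow> nat" where
  "offset M g h = (h + (M - g)) mod M"

lemma sum_offset:
  fixes w :: complex
  assumes "g < M" "w ^ M = 1"
  shows "(\<Sum>h<M. f (offset M g h) * w ^ h) = w ^ g * (\<Sum>D<M. f D * w ^ D)"
proof -
  have wmod: "w ^ (n mod M) = w ^ n" for n
  proof -
    have "w ^ n = w ^ (M * (n div M) + n mod M)" by simp
    then show ?thesis by (simp only: power_add power_mult assms(2)) simp
  qed
  have "w ^ g * (\<Sum>D<M. f D * w ^ D) = (\<Sum>D<M. f D * w ^ (g + D))"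
    by (simp add: sum_distrib_left power_add mult_ac)
  also have "\<dots> = (\<Sum>h<M. f (offset M g h) * w ^ h)"
  proof (rule sum.reindex_bij_witness[of _ "\<lambda>h. offset M g h" "\<lambda>D. (g + D) mod M"])
    fix D assume "D \<in> {..<M}"
    have "((g + D) mod M + (M - g)) mod M = (g + D + (M - g)) mod M"
      by (rule mod_add_left_eq)
    also have "g + D + (M - g) = D + M"
      using assms(1) by simp
    finally show "offset M g ((g + D) mod M) = D"
      using \<open>D \<in> {..<M}\<close> by (simp add: offset_def)
    then show "f (offset M g ((g + D) mod M)) * w ^ ((g + D) mod M) = f D * w ^ (g + D)"
      by (simp add: wmod)
  next
    fix h assume "h \<in> {..<M}"
    have "(g + (h + (M - g)) mod M) mod M = (g + (h + (M - g))) mod M"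
      by (rule mod_add_right_eq)
    also have "g + (h + (M - g)) = h + M"
      using assms(1) by simp
    finally show "(g + offset M g h) mod M = h"
      using \<open>h \<in> {..<M}\<close> by (simp add: offset_def)
  qed (use assms(1) in \<open>auto simp: offset_def\<close>)
  finally show ?thesis ..
qed

text \<open>The residue \<open>D\<close> modulo \<open>2 * u\<close> stands for
  \<open>D + 1/2\<close>. The upper half holds the mirror images, as \<open>2 * u - 1 - p\<close>
  stands for \<open>-(p + 1/2)\<close>.\<close>

definition fold_pos :: "nat \<Rightarrow> nat \<Rightarrow> nat" where
  "fold_pos u D = (if D < u then D else 2 * u - 1 - D)"

lemma fold_pos_less: "D < 2 * u \<Longrightarrow> fold_pos u D < u"
  by (auto simp: fold_pos_def)

lemma sum_fold:
  fixes f :: "nat \<Rightarrow> 'a::comm_monoid_add"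
  shows "(\<Sum>D<2 * u. f D) = (\<Sum>p<u. f p + f (2 * u - 1 - p))"
proof -
  have "(\<Sum>q<u. f (u + q)) = (\<Sum>p<u. f (2 * u - 1 - p))"
    by (rule sum.reindex_bij_witness[of _ "\<lambda>p. u - 1 - p" "\<lambda>p. u - 1 - p"]) auto
  then show ?thesis
    using sum_lessThan_add[of f u u] by (simp add: mult_2 sum.distrib)
qed

text \<open>The group ring coefficient at \<open>D\<close> and \<open>d\<close> of the entry in row
  \<open>r\<close> and column \<open>c\<close>; residues from \<open>u\<close> on carry the
  mirror-image coefficients.\<close>

definition develop_coeff ::
  "block list \<Rightarrow> (nat \<Rightarrow> real) \<Rightarrow> bool list \<Rightarrow> bool list \<Rightarrow> nat \<Rightarrow> bool \<Rightarrow> complex" where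
  "develop_coeff B x r c D d =
     (let u = blocks_length B; p = fold_pos u D
      in if hit B p d r = c then of_real (x (block_var B p)) * unit_entry B p (u \<le> D) d r else 0)"

text \<open>Residues lie half a step below the half-integers they stand for; the common factor
  \<open>cnj \<eta>\<close>, of modulus 1, accounts for this.\<close>

lemma develop_coeff_transform:
  assumes "length r = 2 * length B" "length c = 2 * length B"
    and \<eta>: "\<eta> * cnj \<eta> = 1" "(\<eta>\<^sup>2) ^ (2 * blocks_length B) = 1"
  shows "(\<Sum>D<2 * blocks_length B. develop_coeff B x r c D False * (\<eta>\<^sup>2) ^ D) +
      \<chi> * (\<Sum>D<2 * blocks_length B. develop_coeff B x r c D True * (\<eta>\<^sup>2) ^ D) =
      cnj \<eta> * symbol_matrix B x \<eta> \<chi> r c"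
proof -
  define u where "u = blocks_length B"
  have w1: "(\<eta>\<^sup>2) ^ p = cnj \<eta> * \<eta> ^ (2 * p + 1)" for p
    using \<eta>(1) by (simp add: power_mult mult.left_commute)
  \<comment> \<open>Modulo the period the exponent \<open>2 * u - Suc p\<close> is
    \<open>-(p + 1)\<close>, half a step below \<open>-(p + 1/2)\<close>.\<close>
  have w2: "(\<eta>\<^sup>2) ^ (2 * u - Suc p) = cnj \<eta> * cnj (\<eta> ^ (2 * p + 1))" if "p < u" for p
  proof -
    have "(\<eta>\<^sup>2) ^ (2 * u - Suc p) = (\<eta>\<^sup>2) ^ (2 * u - Suc p) * ((\<eta>\<^sup>2) ^ Suc p * cnj ((\<eta>\<^sup>2) ^ Suc p))"
      by (simp only: unit_power[OF unit_power[OF \<eta>(1)]] mult_1_right)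
    also have "\<dots> = (\<eta>\<^sup>2) ^ (2 * u - Suc p + Suc p) * cnj ((\<eta>\<^sup>2) ^ Suc p)"
      by (simp only: power_add mult.assoc)
    also have "2 * u - Suc p + Suc p = 2 * u" using that by simp
    also have "(\<eta>\<^sup>2) ^ (2 * u) = 1" using \<eta>(2) by (simp add: u_def)
    also have "1 * cnj ((\<eta>\<^sup>2) ^ Suc p) = cnj \<eta> * cnj (\<eta> ^ (2 * p + 1))"
      by (simp add: power2_eq_square power_mult power_mult_distrib mult_ac)
    finally show ?thesis .
  qed
  have "(\<Sum>D<2 * u. develop_coeff B x r c D False * (\<eta>\<^sup>2) ^ D) +
      \<chi> * (\<Sum>D<2 * u. develop_coeff B x r c D True * (\<eta>\<^sup>2) ^ D) =
      (\<Sum>p<u. (develop_coeff B x r c p False + \<chi> * develop_coeff B x r c p True) * (\<eta>\<^sup>2) ^ p +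
        (develop_coeff B x r c (2 * u - Suc p) False + \<chi> * develop_coeff B x r c (2 * u - Suc p) True) *
          (\<eta>\<^sup>2) ^ (2 * u - Suc p))"
    unfolding sum_fold by (simp add: sum_distrib_left sum.distrib algebra_simps)
  also have "\<dots> = (\<Sum>p<u. cnj \<eta> * (symbol_term B x \<eta> \<chi> r c p False + symbol_term B x \<eta> \<chi> r c p True))"
  proof (intro sum.cong refl)
    fix p assume "p \<in> {..<u}"
    then have p: "p < u" by simp
    define v where "v = 2 * u - Suc p"
    have [simp]: "fold_pos u p = p" "fold_pos u v = p" "u \<le> v" "\<not> u \<le> p"
      using p by (auto simp: fold_pos_def v_def)
    show "(develop_coeff B x r c p False + \<chi> * develop_coeff B x r c p True) * (\<eta>\<^sup>2) ^ p +
        (develop_coeff B x r c (2 * u - Suc p) False + \<chi> * develop_coeff B x r c (2 * u - Suc p) True) *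
          (\<eta>\<^sup>2) ^ (2 * u - Suc p) =
       cnj \<eta> * (symbol_term B x \<eta> \<chi> r c p False + symbol_term B x \<eta> \<chi> r c p True)"
      unfolding w2[OF p] w1[of p] unfolding v_def[symmetric]
      unfolding develop_coeff_def symbol_term_def Let_def u_def[symmetric]
      by (simp add: algebra_simps)
  qed
  finally show ?thesis
    unfolding symbol_matrix_eq_sum[OF assms(1,2)] by (simp only: sum_distrib_left u_def)
qed

text \<open>Parseval for the group of order 2. The factors 1 and -1 are written out so that both
  terms have the shape \<open>P False + \<chi> * P True\<close>.\<close>

lemma sum_bool_characters:
  fixes P P' :: "bool \<Rightarrow> complex" and \<kappa> \<kappa>1 :: bool
  shows "2 * (\<Sum>\<kappa>'\<in>UNIV. P (\<kappa> \<noteq> \<kappa>') * cnj (P' (\<kappa>1 \<noteq> \<kappa>'))) =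
    (P False + 1 * P True) * cnj (P' False + 1 * P' True) +
    (if \<kappa> = \<kappa>1 then 1 else -1) * ((P False + (-1) * P True) * cnj (P' False + (-1) * P' True))"
  by (cases \<kappa>; cases \<kappa>1) (simp_all add: UNIV_bool algebra_simps)

text \<open>At every character the symbol matrix has orthogonal rows of the same norm. Parseval
  carries this back to the group, where orthogonality of characters singles out
  \<open>g = g'\<close> and \<open>\<kappa> = \<kappa>1\<close>.\<close>

lemma develop_orthogonal:
  fixes \<kappa> \<kappa>1 :: bool
  assumes B: "golay_blocks B" and r: "length r = 2 * length B" "length r' = 2 * length B"
    and M: "M = 2 * blocks_length B" and g: "g < M" "g' < M"
  shows "(\<Sum>c | length c = 2 * length B. \<Sum>h<M. \<Sum>\<kappa>'\<in>UNIV.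
      develop_coeff B x r c (offset M g h) (\<kappa> \<noteq> \<kappa>') *
      cnj (develop_coeff B x r' c (offset M g' h) (\<kappa>1 \<noteq> \<kappa>'))) =
    (if g = g' \<and> \<kappa> = \<kappa>1 \<and> r = r' then of_real (4 * blocks_norm B x) else 0)"
    (is "?S = _")
proof -
  have M0: "M > 0" using g by simp
  define w where "w = cis (2 * pi / real M)"
  \<comment> \<open>Half-integer positions require a square root of each
    \<open>w ^ t\<close>.\<close>
  define \<eta> where "\<eta> = (\<lambda>t. cis (pi / real M) ^ t)"
  have \<eta>2: "w ^ t = (\<eta> t)\<^sup>2" for t
    by (simp add: w_def \<eta>_def Complex.DeMoivre field_simps)
  have \<eta>1: "\<eta> t * cnj (\<eta> t) = 1" for t
    unfolding \<eta>_def by (rule unit_power) (simp flip: complex_norm_square)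
  have wM: "(w ^ t) ^ M = 1" for t
  proof -
    have "w ^ M = 1" using M0 by (simp add: w_def Complex.DeMoivre)
    then show ?thesis by (metis power_commutes power_mult mult.commute power_one)
  qed
  have \<eta>M: "((\<eta> t)\<^sup>2) ^ (2 * blocks_length B) = 1" for t
    using wM[of t] unfolding M \<eta>2 .
  define P where "P r c t d = (\<Sum>D<M. develop_coeff B x r c D d * (w ^ t) ^ D)" for r c t d
  have P: "P r c t False + \<chi> * P r c t True = cnj (\<eta> t) * symbol_matrix B x (\<eta> t) \<chi> r c"
    if "length r = 2 * length B" "length c = 2 * length B" for r c t \<chi>
    using develop_coeff_transform[OF that \<eta>1 \<eta>M] unfolding P_def \<eta>2 M .
  have char: "(\<Sum>c | length c = 2 * length B. (P r c t False + \<chi> * P r c t True) *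
      cnj (P r' c t False + \<chi> * P r' c t True)) = (if r = r' then of_real (4 * blocks_norm B x) else 0)"
    if "cnj \<chi> = \<chi>" "\<chi> * \<chi> = 1" for t \<chi>
  proof -
    have "(\<Sum>c | length c = 2 * length B. (P r c t False + \<chi> * P r c t True) *
      cnj (P r' c t False + \<chi> * P r' c t True)) =
      (\<Sum>c | length c = 2 * length B. (\<eta> t * cnj (\<eta> t)) *
        (symbol_matrix B x (\<eta> t) \<chi> r c * cnj (symbol_matrix B x (\<eta> t) \<chi> r' c)))"
      by (intro sum.cong refl) (simp add: P r)
    then show ?thesis
      unfolding \<eta>1 mult_1 using symbol_matrix_orthogonal[OF B r \<eta>1 that] by simp
  qed
  have shift: "(\<Sum>h<M. develop_coeff B x r c (offset M g h) d * (w ^ t) ^ h) = (w ^ t) ^ g * P r c t d"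
    if "g < M" for g r c d t
    unfolding P_def by (rule sum_offset[OF that wM])
  have correlation: "of_nat M * (\<Sum>h<M. develop_coeff B x r c (offset M g h) d *
      cnj (develop_coeff B x r' c (offset M g' h) d')) =
      (\<Sum>t<M. ((w ^ t) ^ g * cnj ((w ^ t) ^ g')) * (P r c t d * cnj (P r' c t d')))" for c d d'
    unfolding parseval[OF M0] w_def[symmetric] shift[OF g(1)] shift[OF g(2)]
    by (simp add: mult_ac)
  have "2 * of_nat M * ?S = 2 * (\<Sum>c | length c = 2 * length B. \<Sum>\<kappa>'\<in>UNIV. of_nat M * (\<Sum>h<M.
      develop_coeff B x r c (offset M g h) (\<kappa> \<noteq> \<kappa>') *
      cnj (develop_coeff B x r' c (offset M g' h) (\<kappa>1 \<noteq> \<kappa>'))))"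
    unfolding sum_distrib_left[symmetric] mult.assoc
    by (intro arg_cong2[of _ _ _ _ "(*)"] refl sum.cong sum.swap)
  also have "\<dots> = 2 * (\<Sum>c | length c = 2 * length B. \<Sum>\<kappa>'\<in>UNIV. \<Sum>t<M.
      ((w ^ t) ^ g * cnj ((w ^ t) ^ g')) * (P r c t (\<kappa> \<noteq> \<kappa>') * cnj (P r' c t (\<kappa>1 \<noteq> \<kappa>'))))"
    by (simp only: correlation)
  also have "\<dots> = (\<Sum>t<M. ((w ^ t) ^ g * cnj ((w ^ t) ^ g')) * (\<Sum>c | length c = 2 * length B.
      2 * (\<Sum>\<kappa>'\<in>UNIV. P r c t (\<kappa> \<noteq> \<kappa>') * cnj (P r' c t (\<kappa>1 \<noteq> \<kappa>')))))"
  proof -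
    have "(\<Sum>c | length c = 2 * length B. \<Sum>\<kappa>'\<in>UNIV. \<Sum>t<M.
        ((w ^ t) ^ g * cnj ((w ^ t) ^ g')) * (P r c t (\<kappa> \<noteq> \<kappa>') * cnj (P r' c t (\<kappa>1 \<noteq> \<kappa>')))) =
      (\<Sum>c | length c = 2 * length B. \<Sum>t<M. \<Sum>\<kappa>'\<in>UNIV.
        ((w ^ t) ^ g * cnj ((w ^ t) ^ g')) * (P r c t (\<kappa> \<noteq> \<kappa>') * cnj (P r' c t (\<kappa>1 \<noteq> \<kappa>'))))"
      by (intro sum.cong refl sum.swap)
    also have "\<dots> = (\<Sum>t<M. \<Sum>c | length c = 2 * length B. \<Sum>\<kappa>'\<in>UNIV.
        ((w ^ t) ^ g * cnj ((w ^ t) ^ g')) * (P r c t (\<kappa> \<noteq> \<kappa>') * cnj (P r' c t (\<kappa>1 \<noteq> \<kappa>'))))"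
      by (rule sum.swap)
    finally show ?thesis
      by (simp only: sum_distrib_left mult_ac)
  qed
  \<comment> \<open>Both sign characters give the same scalar; the two terms add for
    \<open>\<kappa> = \<kappa>1\<close> and cancel otherwise.\<close>
  also have "\<dots> = (\<Sum>t<M. ((w ^ t) ^ g * cnj ((w ^ t) ^ g')) *
      ((if r = r' then of_real (4 * blocks_norm B x) else 0) +
       (if \<kappa> = \<kappa>1 then 1 else -1) * (if r = r' then of_real (4 * blocks_norm B x) else 0)))"
    unfolding sum_bool_characters sum.distrib sum_distrib_left[symmetric]
    by (subst (1 2) char) simp_all
  also have "\<dots> = 2 * of_nat M *
      (if g = g' \<and> \<kappa> = \<kappa>1 \<and> r = r' then of_real (4 * blocks_norm B x) else 0)"
    unfolding sum_distrib_right[symmetric] w_def dft_orthogonality[OF M0 g] by simp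
  finally show ?thesis
    using M0 by simp
qed

section \<open>Orthogonal designs\<close>

text \<open>Sylvester's matrix, the tensor power of [[1, 1], [1, -1]], indexed by bit lists.\<close>

fun hadamard :: "bool list \<Rightarrow> bool list \<Rightarrow> complex" where
  "hadamard (a # c) (b # y) = (if a \<and> b then -1 else 1) * hadamard c y"
| "hadamard _ _ = 1"

lemma hadamard_quaternary: "hadamard c y \<in> quaternary"
  by (induction c y rule: hadamard.induct) (auto simp: quaternary_def)

lemma cnj_hadamard [simp]: "cnj (hadamard c y) = hadamard c y"
  by (induction c y rule: hadamard.induct) auto

lemma hadamard_orthogonal:
  assumes "length c = n" "length c' = n"
  shows "(\<Sum>y | length y = n. hadamard c y * hadamard c' y) = (if c = c' then 2 ^ n else 0)"
  using assms
proof (induction n arbitrary: c c')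
  case 0
  have "{y :: bool list. length y = 0} = {[]}" by auto
  then show ?case using 0 by simp
next
  case (Suc n)
  obtain a d where c: "c = a # d" "length d = n" using Suc.prems(1) by (auto simp: length_Suc_conv)
  obtain a' d' where c': "c' = a' # d'" "length d' = n" using Suc.prems(2) by (auto simp: length_Suc_conv)
  have "(\<Sum>y | length y = Suc n. hadamard c y * hadamard c' y) =
      (\<Sum>y | length y = n. (if a = a' then 2 else 0) * (hadamard d y * hadamard d' y))"
    unfolding sum_bool_lists_Suc c(1) c'(1) by (intro sum.cong refl) (cases a; cases a'; simp)
  also have "\<dots> = (if a = a' then 2 else 0) * (if d = d' then 2 ^ n else 0)"
    unfolding sum_distrib_left[symmetric] Suc.IH[OF c(2) c'(2)] ..
  finally show ?case by (simp add: c c')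
qed

text \<open>Bijections number the rows and columns, so that later constructions may index them by
  group elements and bit lists.\<close>

lemma orthogonal_design_of_signs:
  fixes R :: "'r set" and C :: "'c set" and \<sigma> :: "'r \<Rightarrow> 'c \<Rightarrow> real"
  assumes fin: "finite R" "finite C" and card: "card R = n" "card C = n"
    and pos: "\<And>i. i \<in> {1..k} \<Longrightarrow> 0 < s i"
    and var: "\<And>r c. r \<in> R \<Longrightarrow> c \<in> C \<Longrightarrow> v r c \<in> {1..k}"
    and sign: "\<And>r c. r \<in> R \<Longrightarrow> c \<in> C \<Longrightarrow> \<sigma> r c \<in> {1, -1}"
    and orth: "\<And>x r r'. r \<in> R \<Longrightarrow> r' \<in> R \<Longrightarrow>
      (\<Sum>c\<in>C. (\<sigma> r c * x (v r c)) * (\<sigma> r' c * x (v r' c))) =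
      (if r = r' then \<Sum>i=1..k. real (s i) * (x i)\<^sup>2 else 0)"
  shows "\<exists>X. orthogonal_design n k s X"
proof -
  obtain \<rho> where \<rho>: "bij_betw \<rho> {0..<n} R"
    using ex_bij_betw_nat_finite[OF fin(1)] card(1) by auto
  obtain \<gamma> where \<gamma>: "bij_betw \<gamma> {0..<n} C"
    using ex_bij_betw_nat_finite[OF fin(2)] card(2) by auto
  have \<rho>R: "\<rho> i \<in> R" if "i < n" for i using \<rho> that by (auto simp: bij_betw_def)
  have \<gamma>C: "\<gamma> i \<in> C" if "i < n" for i using \<gamma> that by (auto simp: bij_betw_def)
  have \<rho>inj: "\<rho> i = \<rho> j \<longleftrightarrow> i = j" if "i < n" "j < n" for i j
    using \<rho> that by (auto simp: bij_betw_def inj_on_def)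
  define e where "e r c = (if \<sigma> r c = 1 then Plus_var (v r c) else Minus_var (v r c))" for r c
  define X where "X = mat n n (\<lambda>(i, j). e (\<rho> i) (\<gamma> j))"
  have e: "entry_val x (e r c) = \<sigma> r c * x (v r c)" if "r \<in> R" "c \<in> C" for x r c
    using sign[OF that] by (auto simp: e_def)
  have "map_mat (entry_val x) X * transpose_mat (map_mat (entry_val x) X) =
        (\<Sum>i=1..k. real (s i) * (x i)\<^sup>2) \<cdot>\<^sub>m 1\<^sub>m n" (is "?L = ?R") for x
  proof (rule eq_matI)
    fix i j assume "i < dim_row ?R" "j < dim_col ?R"
    then have ij: "i < n" "j < n" by auto
    have "?L $$ (i, j) = (\<Sum>l\<in>{0..<n}. entry_val x (e (\<rho> i) (\<gamma> l)) * entry_val x (e (\<rho> j) (\<gamma> l)))"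
      using ij by (simp add: X_def scalar_prod_def)
    also have "\<dots> = (\<Sum>c\<in>C. entry_val x (e (\<rho> i) c) * entry_val x (e (\<rho> j) c))"
      by (rule sum.reindex_bij_betw[OF \<gamma>])
    also have "\<dots> = (\<Sum>c\<in>C. (\<sigma> (\<rho> i) c * x (v (\<rho> i) c)) * (\<sigma> (\<rho> j) c * x (v (\<rho> j) c)))"
      using ij by (intro sum.cong refl) (simp add: e \<rho>R)
    also have "\<dots> = ?R $$ (i, j)"
      using ij by (simp add: orth \<rho>R \<rho>inj)
    finally show "?L $$ (i, j) = ?R $$ (i, j)" .
  qed (auto simp: X_def)
  moreover have "elements_mat X \<subseteq> {Zero_entry} \<union> Plus_var ` {1..k} \<union> Minus_var ` {1..k}"
  proof
    fix y assume "y \<in> elements_mat X"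
    then obtain i j where "i < n" "j < n" "y = e (\<rho> i) (\<gamma> j)"
      by (auto simp: elements_mat_def X_def)
    then show "y \<in> {Zero_entry} \<union> Plus_var ` {1..k} \<union> Minus_var ` {1..k}"
      using var[OF \<rho>R \<gamma>C] by (auto simp: e_def)
  qed
  ultimately have "orthogonal_design n k s X"
    unfolding orthogonal_design_def using pos by (auto simp: X_def)
  then show ?thesis ..
qed

section \<open>From quaternary to real entries\<close>

lemma sum_bool_prod: "(\<Sum>p\<in>A \<times> (UNIV :: bool set). f p) = (\<Sum>a\<in>A. f (a, False) + f (a, True))"
  unfolding sum.cartesian_product[of "\<lambda>a b. f (a, b)", simplified, symmetric]
  by (simp add: UNIV_bool add.commute)

text \<open>An entry \<open>z\<close> becomes the real matrix of multiplication by \<open>z\<close>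
  times [[1, 1], [1, -1]]. Exactly one of \<open>Re z\<close> and \<open>Im z\<close> is nonzero, so
  all four entries are signs.\<close>

lemma orthogonal_design_of_quaternary:
  fixes R :: "'r set" and C :: "'c set" and q :: "'r \<Rightarrow> 'c \<Rightarrow> complex"
  assumes fin: "finite R" "finite C" and card: "card R = n" "card C = n"
    and pos: "\<And>i. i \<in> {1..k} \<Longrightarrow> 0 < s i"
    and var: "\<And>r c. r \<in> R \<Longrightarrow> c \<in> C \<Longrightarrow> v r c \<in> {1..k}"
    and quat: "\<And>r c. r \<in> R \<Longrightarrow> c \<in> C \<Longrightarrow> q r c \<in> quaternary"
    and orth: "\<And>x r r'. r \<in> R \<Longrightarrow> r' \<in> R \<Longrightarrow>
      (\<Sum>c\<in>C. (of_real (x (v r c)) * q r c) * cnj (of_real (x (v r' c)) * q r' c)) =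
      (if r = r' then of_real (\<Sum>i=1..k. real (s i) * (x i)\<^sup>2) else 0)"
  shows "\<exists>X. orthogonal_design (2 * n) k (\<lambda>i. 2 * s i) X"
proof -
  define \<sigma> where "\<sigma> = (\<lambda>(r, e :: bool) (c, e').
    if e = e' then (if e then Im (q r c) - Re (q r c) else Re (q r c) - Im (q r c))
    else Re (q r c) + Im (q r c))"
  show ?thesis
  proof (rule orthogonal_design_of_signs[where R = "R \<times> UNIV" and C = "C \<times> (UNIV :: bool set)"
      and v = "\<lambda>(r, _) (c, _). v r c" and \<sigma> = \<sigma>], goal_cases)
    case (7 r c)
    have "q (fst r) (fst c) \<in> quaternary"
      using 7 by (intro quat) auto
    then show ?case
      by (cases r; cases c) (auto simp: quaternary_def \<sigma>_def)
  next
    case (8 x r r')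
    obtain r0 e where r: "r = (r0, e)" by (cases r)
    obtain r1 e' where r': "r' = (r1, e')" by (cases r')
    have mem: "r0 \<in> R" "r1 \<in> R" using 8 by (auto simp: r r')
    define T where "T = (\<Sum>c\<in>C. (of_real (x (v r0 c)) * q r0 c) * cnj (of_real (x (v r1 c)) * q r1 c))"
    have re: "Re T = (\<Sum>c\<in>C. x (v r0 c) * x (v r1 c) * (Re (q r0 c) * Re (q r1 c) + Im (q r0 c) * Im (q r1 c)))"
      and im: "Im T = (\<Sum>c\<in>C. x (v r0 c) * x (v r1 c) * (Im (q r0 c) * Re (q r1 c) - Re (q r0 c) * Im (q r1 c)))"
      unfolding T_def by (simp_all add: algebra_simps)
    have "(\<Sum>c\<in>C \<times> UNIV. (\<sigma> r c * x ((\<lambda>(r, _) (c, _). v r c) r c)) * (\<sigma> r' c * x ((\<lambda>(r, _) (c, _). v r c) r' c))) =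
        2 * (if e = e' then Re T else if e then Im T else - Im T)"
      unfolding sum_bool_prod r r' re im sum_distrib_left sum_negf[symmetric] if_distrib[of "\<lambda>z. 2 * z"]
      by (cases e; cases e') (auto simp: \<sigma>_def algebra_simps intro!: sum.cong)
    \<comment> \<open>\<open>T\<close> is real by \<open>orth\<close>, so the two rows of one block
      are orthogonal to each other.\<close>
    also have "\<dots> = (if r = r' then \<Sum>i=1..k. real (2 * s i) * (x i)\<^sup>2 else 0)"
      unfolding T_def orth[OF mem] r r' by (auto simp: sum_distrib_left mult_ac)
    finally show ?case .
  qed (use fin card pos var in \<open>auto simp: card_cartesian_product\<close>)
qed

text \<open>The Kronecker product with a Hadamard matrix of order \<open>2 ^ t\<close> reaches all
  larger powers of 2.\<close>

lemma orthogonal_design_of_quaternary_scaled: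
  fixes R :: "'r set" and C :: "'c set" and q :: "'r \<Rightarrow> 'c \<Rightarrow> complex"
  assumes fin: "finite R" "finite C" and card: "card R = n" "card C = n"
    and pos: "\<And>i. i \<in> {1..k} \<Longrightarrow> 0 < s i"
    and var: "\<And>r c. r \<in> R \<Longrightarrow> c \<in> C \<Longrightarrow> v r c \<in> {1..k}"
    and quat: "\<And>r c. r \<in> R \<Longrightarrow> c \<in> C \<Longrightarrow> q r c \<in> quaternary"
    and orth: "\<And>x r r'. r \<in> R \<Longrightarrow> r' \<in> R \<Longrightarrow>
      (\<Sum>c\<in>C. (of_real (x (v r c)) * q r c) * cnj (of_real (x (v r' c)) * q r' c)) =
      (if r = r' then of_real (\<Sum>i=1..k. real (s i) * (x i)\<^sup>2) else 0)"
  shows "\<exists>X. orthogonal_design (2 * (2 ^ t * n)) k (\<lambda>i. 2 * (2 ^ t * s i)) X"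
proof -
  let ?T = "{y :: bool list. length y = t}"
  have cardT: "card ?T = 2 ^ t"
    using card_lists_length_eq[of "UNIV :: bool set" t] by simp
  show ?thesis
  proof (rule orthogonal_design_of_quaternary[where R = "R \<times> ?T" and C = "C \<times> ?T"
      and v = "\<lambda>(r, _) (c, _). v r c" and q = "\<lambda>(r, y) (c, z). q r c * hadamard y z"], goal_cases)
    case (7 r c)
    then show ?case using quat hadamard_quaternary by (auto intro!: quaternary_mult)
  next
    case (8 x r r')
    obtain r0 y where r: "r = (r0, y)" by (cases r)
    obtain r1 y' where r': "r' = (r1, y')" by (cases r')
    have mem: "r0 \<in> R" "r1 \<in> R" "length y = t" "length y' = t" using 8 by (auto simp: r r')
    let ?v = "\<lambda>(r, _) (c, _). v r c" and ?q = "\<lambda>(r, y) (c, z). q r c * hadamard y z"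
    have "(\<Sum>c\<in>C \<times> ?T. (of_real (x (?v r c)) * ?q r c) * cnj (of_real (x (?v r' c)) * ?q r' c)) =
        (\<Sum>c\<in>C. \<Sum>z | length z = t. ((of_real (x (v r0 c)) * q r0 c) * cnj (of_real (x (v r1 c)) * q r1 c)) *
          (hadamard y z * hadamard y' z))"
      unfolding sum.cartesian_product by (intro sum.cong refl) (auto simp: r r' mult_ac)
    also have "\<dots> = (if r0 = r1 then of_real (\<Sum>i=1..k. real (s i) * (x i)\<^sup>2) else 0) *
        (if y = y' then 2 ^ t else 0)"
      unfolding sum_distrib_left[symmetric] sum_distrib_right[symmetric]
        hadamard_orthogonal[OF mem(3,4)] orth[OF mem(1,2)] ..
    also have "\<dots> = (if r = r' then of_real (\<Sum>i=1..k. real (2 ^ t * s i) * (x i)\<^sup>2) else 0)"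
      by (auto simp: r r' sum_distrib_left mult_ac)
    finally show ?case .
  qed (use fin card cardT pos var in \<open>auto simp: card_cartesian_product\<close>)
qed

section \<open>Assembly of the design\<close>

lemma hit_length: "length r = 2 * length B \<Longrightarrow> length (hit B p d r) = 2 * length B"
  by (induction B p d r rule: hit.induct) auto

lemma unit_entry_quaternary: "golay_blocks B \<Longrightarrow> unit_entry B p s d r \<in> quaternary"
  by (induction B p s d r rule: unit_entry.induct)
     (auto simp: golay_blocks_def golay_pair_def image_subset_iff
       intro!: quaternary_cnj quaternary_uminus quaternary_1)

text \<open>For fixed \<open>h\<close> and \<kappa>' a row of the developed matrix has one nonzero
  column; multiplication by a Hadamard matrix replaces it by a full Hadamard row. The 3 in the
  exponent counts the doublings by mirror images, by the sign bit and by real blocks.\<close>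

lemma orthogonal_design_of_blocks:
  assumes B: "golay_blocks B"
    and pos: "\<And>i. i \<in> {1..k} \<Longrightarrow> 0 < s i"
    and var: "\<And>p. p < blocks_length B \<Longrightarrow> block_var B p \<in> {1..k}"
    and norm: "\<And>x. blocks_norm B x = (\<Sum>i=1..k. real (s i) * (x i)\<^sup>2)"
    and n: "2 * length B + 3 \<le> n"
  shows "\<exists>X. orthogonal_design (2 ^ n * blocks_length B) k (\<lambda>i. 2 ^ n * s i) X"
proof -
  define u where "u = blocks_length B"
  define M where "M = 2 * u"
  define L where "L = 2 * length B"
  let ?R = "{..<M} \<times> (UNIV :: bool set) \<times> {r :: bool list. length r = L}"
  define v where "v = (\<lambda>(g, \<kappa> :: bool, r :: bool list) (h, \<kappa>' :: bool, y :: bool list).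
    block_var B (fold_pos u (offset M g h)))"
  define q where "q = (\<lambda>(g, \<kappa> :: bool, r :: bool list) (h, \<kappa>', y).
    unit_entry B (fold_pos u (offset M g h)) (u \<le> offset M g h) (\<kappa> \<noteq> \<kappa>') r *
    hadamard (hit B (fold_pos u (offset M g h)) (\<kappa> \<noteq> \<kappa>') r) y)"
  have off: "fold_pos u (offset M g h) < u" if "g < M" for g h
    using that by (intro fold_pos_less) (simp add: offset_def M_def)
  have "card {r :: bool list. length r = L} = 2 ^ L"
    using card_lists_length_eq[of "UNIV :: bool set" L] by simp
  then have card: "card ?R = 4 * u * 2 ^ L"
    by (simp add: card_cartesian_product M_def)
  \<comment> \<open>The part of \<open>n\<close> beyond \<open>L + 3\<close> is filled by a further
    Hadamard factor.\<close>
  have "\<exists>X. orthogonal_design (2 * (2 ^ (n - L - 3) * (4 * u * 2 ^ L))) k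
      (\<lambda>i. 2 * (2 ^ (n - L - 3) * (4 * 2 ^ L * s i))) X"
  proof (rule orthogonal_design_of_quaternary_scaled[where R = ?R and C = ?R and v = v and q = q], goal_cases)
    case (6 r c)
    then show ?case using var[OF off[unfolded u_def]] by (auto simp: v_def u_def)
  next
    case (7 r c)
    then show ?case
      using unit_entry_quaternary[OF B] hadamard_quaternary by (auto simp: q_def intro!: quaternary_mult)
  next
    case (8 x R1 R2)
    obtain g \<kappa> r where R1: "R1 = (g, \<kappa>, r)" by (cases R1)
    obtain g' \<kappa>1 r' where R2: "R2 = (g', \<kappa>1, r')" by (cases R2)
    have mem: "g < M" "g' < M" "length r = L" "length r' = L"
      using 8 by (auto simp: R1 R2)
    define hc where "hc g \<kappa> r h \<kappa>' = hit B (fold_pos u (offset M g h)) (\<kappa> \<noteq> \<kappa>') r"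
      for g r h and \<kappa> \<kappa>' :: bool
    define z where "z g \<kappa> r h \<kappa>' = of_real (x (block_var B (fold_pos u (offset M g h)))) *
      unit_entry B (fold_pos u (offset M g h)) (u \<le> offset M g h) (\<kappa> \<noteq> \<kappa>') r" for g r h and \<kappa> \<kappa>' :: bool
    have hcL: "length (hc g \<kappa> r h \<kappa>') = L" "length (hc g' \<kappa>1 r' h \<kappa>') = L" for h \<kappa>'
      using hit_length mem(3,4) by (auto simp: hc_def L_def)
    have coeff: "develop_coeff B x r c (offset M g h) (\<kappa> \<noteq> \<kappa>') = (if hc g \<kappa> r h \<kappa>' = c then z g \<kappa> r h \<kappa>' else 0)"
      for r c g h and \<kappa> \<kappa>' :: bool
      by (simp add: develop_coeff_def Let_def hc_def z_def u_def)
    have "(\<Sum>c\<in>?R. (of_real (x (v R1 c)) * q R1 c) * cnj (of_real (x (v R2 c)) * q R2 c)) =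
        (\<Sum>h<M. \<Sum>\<kappa>'\<in>UNIV. \<Sum>y | length y = L. (z g \<kappa> r h \<kappa>' * cnj (z g' \<kappa>1 r' h \<kappa>')) *
          (hadamard (hc g \<kappa> r h \<kappa>') y * hadamard (hc g' \<kappa>1 r' h \<kappa>') y))"
      unfolding sum.cartesian_product
      by (intro sum.cong refl) (auto simp: v_def q_def R1 R2 z_def hc_def mult_ac)
    also have "\<dots> = (\<Sum>h<M. \<Sum>\<kappa>'\<in>UNIV. 2 ^ L * (\<Sum>c | length c = L.
        develop_coeff B x r c (offset M g h) (\<kappa> \<noteq> \<kappa>') *
        cnj (develop_coeff B x r' c (offset M g' h) (\<kappa>1 \<noteq> \<kappa>'))))"
    proof (intro sum.cong refl)
      fix h and \<kappa>' :: bool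
      \<comment> \<open>The two rows can only meet if their single nonzero columns coincide, just as
        two Hadamard rows have a nonzero product only if they are equal.\<close>
      have "(\<Sum>c | length c = L. develop_coeff B x r c (offset M g h) (\<kappa> \<noteq> \<kappa>') *
          cnj (develop_coeff B x r' c (offset M g' h) (\<kappa>1 \<noteq> \<kappa>'))) =
        (\<Sum>c | length c = L. if c = hc g \<kappa> r h \<kappa>' then
           (if hc g \<kappa> r h \<kappa>' = hc g' \<kappa>1 r' h \<kappa>' then z g \<kappa> r h \<kappa>' * cnj (z g' \<kappa>1 r' h \<kappa>') else 0) else 0)"
        unfolding coeff by (intro sum.cong refl) auto
      also have "\<dots> = (if hc g \<kappa> r h \<kappa>' = hc g' \<kappa>1 r' h \<kappa>' then z g \<kappa> r h \<kappa>' * cnj (z g' \<kappa>1 r' h \<kappa>') else 0)"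
        by (subst sum.delta) (auto simp: hcL)
      finally show "(\<Sum>y | length y = L. (z g \<kappa> r h \<kappa>' * cnj (z g' \<kappa>1 r' h \<kappa>')) *
          (hadamard (hc g \<kappa> r h \<kappa>') y * hadamard (hc g' \<kappa>1 r' h \<kappa>') y)) =
        2 ^ L * (\<Sum>c | length c = L. develop_coeff B x r c (offset M g h) (\<kappa> \<noteq> \<kappa>') *
          cnj (develop_coeff B x r' c (offset M g' h) (\<kappa>1 \<noteq> \<kappa>')))"
        unfolding sum_distrib_left[symmetric] hadamard_orthogonal[OF hcL] by simp
    qed
    also have "\<dots> = 2 ^ L * (\<Sum>c | length c = L. \<Sum>h<M. \<Sum>\<kappa>'\<in>UNIV.
        develop_coeff B x r c (offset M g h) (\<kappa> \<noteq> \<kappa>') *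
        cnj (develop_coeff B x r' c (offset M g' h) (\<kappa>1 \<noteq> \<kappa>')))"
      unfolding sum_distrib_left[symmetric]
      by (subst (3) sum.swap, subst (2) sum.swap) (rule refl)
    also have "\<dots> = 2 ^ L * (if g = g' \<and> \<kappa> = \<kappa>1 \<and> r = r' then of_real (4 * blocks_norm B x) else 0)"
      using develop_orthogonal[OF B, of r r' M g g' x \<kappa> \<kappa>1] mem by (simp add: L_def M_def u_def)
    also have "\<dots> = (if R1 = R2 then of_real (\<Sum>i=1..k. real (4 * 2 ^ L * s i) * (x i)\<^sup>2) else 0)"
      by (auto simp: R1 R2 norm sum_distrib_left mult_ac)
    finally show ?case .
  qed (use card pos in auto)
  moreover have "2 ^ n = 2 * (2 ^ (n - L - 3) * (4 * 2 ^ L :: nat))"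
  proof -
    have "n = Suc (Suc (Suc (n - L - 3 + L)))" using n by (simp add: L_def)
    then have "2 ^ n = (2 :: nat) ^ Suc (Suc (Suc (n - L - 3 + L)))" by (rule arg_cong)
    then show ?thesis by (simp add: power_add)
  qed
  ultimately show ?thesis
    by (simp add: u_def mult_ac)
qed

section \<open>Blocks from sums of Golay lengths\<close>

definition golay_block :: "nat \<Rightarrow> nat \<Rightarrow> block" where
  "golay_block i g = (let (a, b) = SOME (a, b). golay_pair g a b in (i, g, a, b))"

lemma golay_blockE:
  assumes "golay_length g"
  obtains a b where "golay_block i g = (i, g, a, b)" "golay_pair g a b"
proof -
  define p where "p = (SOME (a, b). golay_pair g a b)"
  have "case p of (a, b) \<Rightarrow> golay_pair g a b"
    unfolding p_def using assms someI_ex[of "\<lambda>(a, b). golay_pair g a b"]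
    by (auto simp: golay_length_def)
  then show ?thesis
    using that[of "fst p" "snd p"] by (simp add: golay_block_def p_def case_prod_unfold)
qed

lemma blocks_length_append: "blocks_length (B @ B') = blocks_length B + blocks_length B'"
  by (induction B rule: blocks_length.induct) auto

lemma blocks_norm_append: "blocks_norm (B @ B') x = blocks_norm B x + blocks_norm B' x"
  by (induction B x rule: blocks_norm.induct) auto

lemma block_var_in: "p < blocks_length B \<Longrightarrow> block_var B p \<in> fst ` set B"
  by (induction B p rule: block_var.induct) auto

lemma golay_blocks_map:
  assumes "\<forall>g\<in>set gs. golay_length g"
  shows "blocks_length (map (golay_block i) gs) = sum_list gs"
    and "blocks_norm (map (golay_block i) gs) x = real (sum_list gs) * (x i)\<^sup>2"
    and "golay_blocks (map (golay_block i) gs)"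
    and "fst ` set (map (golay_block i) gs) \<subseteq> {i}"
proof -
  have "blocks_length (map (golay_block i) gs) = sum_list gs \<and>
    blocks_norm (map (golay_block i) gs) x = real (sum_list gs) * (x i)\<^sup>2 \<and>
    golay_blocks (map (golay_block i) gs) \<and> fst ` set (map (golay_block i) gs) \<subseteq> {i}"
    using assms
  proof (induction gs)
    case (Cons g gs)
    from Cons.prems have "golay_length g" by simp
    then obtain a b where "golay_block i g = (i, g, a, b)" "golay_pair g a b"
      by (rule golay_blockE[of g i])
    then show ?case
      using Cons by (auto simp: golay_blocks_def algebra_simps)
  qed (simp add: golay_blocks_def)
  then show "blocks_length (map (golay_block i) gs) = sum_list gs"
    "blocks_norm (map (golay_block i) gs) x = real (sum_list gs) * (x i)\<^sup>2"
    "golay_blocks (map (golay_block i) gs)" "fst ` set (map (golay_block i) gs) \<subseteq> {i}"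
    by auto
qed

lemma golay_blocks_exist:
  assumes "\<And>i. i \<in> {1..k} \<Longrightarrow> golay_sum (l i) (u i)"
  shows "\<exists>B. golay_blocks B \<and> length B \<le> (\<Sum>i=1..k. l i) \<and> blocks_length B = (\<Sum>i=1..k. u i) \<and>
    (\<forall>x. blocks_norm B x = (\<Sum>i=1..k. real (u i) * (x i)\<^sup>2)) \<and> fst ` set B \<subseteq> {1..k}"
  using assms
proof (induction k)
  case 0
  then show ?case by (intro exI[of _ "[]"]) (simp add: golay_blocks_def)
next
  case (Suc k)
  obtain B where B: "golay_blocks B" "length B \<le> (\<Sum>i=1..k. l i)" "blocks_length B = (\<Sum>i=1..k. u i)"
    "\<And>x. blocks_norm B x = (\<Sum>i=1..k. real (u i) * (x i)\<^sup>2)" "fst ` set B \<subseteq> {1..k}"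
    using Suc.IH Suc.prems by auto
  obtain gs where gs: "length gs \<le> l (Suc k)" "\<forall>g\<in>set gs. golay_length g" "sum_list gs = u (Suc k)"
    using Suc.prems[of "Suc k"] by (auto simp: golay_sum_def)
  note blk = golay_blocks_map[OF gs(2), of "Suc k"]
  have "fst ` set (B @ map (golay_block (Suc k)) gs) \<subseteq> {1..Suc k}"
  proof -
    have "fst ` set B \<union> fst ` set (map (golay_block (Suc k)) gs) \<subseteq> {1..k} \<union> {Suc k}"
      using B(5) blk(4) by (rule Un_mono)
    also have "\<dots> \<subseteq> {1..Suc k}" by auto
    finally show ?thesis by (simp only: set_append image_Un)
  qed
  moreover have "golay_blocks (B @ map (golay_block (Suc k)) gs)"
    using B(1) blk(3) by (auto simp: golay_blocks_def)
  ultimately show ?case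
    using B gs(1,3) blk
    by (intro exI[of _ "B @ map (golay_block (Suc k)) gs"])
       (simp add: blocks_length_append blocks_norm_append)
qed

section \<open>The bound on the exponent\<close>

lemma log2_eq_log: "0 < u \<Longrightarrow> log2 (real u) = log 2 (real u)"
  by (simp add: log2_def)

text \<open>For \<open>u \<ge> 2\<close> one has \<open>u \<le> 2 * (u - 1)\<close>; for
  \<open>u = 1\<close> both logarithms are 0, the second by convention.\<close>

lemma log2_pred:
  assumes "0 < u"
  shows "log2 (real u) \<le> log2 (real u - 1) + 1"
proof (cases "u = 1")
  case False
  then have "log 2 (real u) \<le> log 2 (2 * (real u - 1))"
    using assms by (intro log_mono) auto
  also have "\<dots> = log 2 (real u - 1) + 1"
    using assms False by (subst log_mult) auto
  finally show ?thesis
    using assms False by (simp add: log2_def)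
qed (simp add: log2_def)

theorem theorem9:
  fixes k :: nat and u :: "nat \<Rightarrow> nat"
  assumes "1 \<le> k"
    and "\<And>i. i \<in> {1..k} \<Longrightarrow> 0 < u i"
    and "\<And>i. i \<in> {2..k} \<Longrightarrow>
           int (lc (u 1)) - int (lc (u 1 - 1)) \<ge> int (lc (u i)) - int (lc (u i - 1))"
  shows "\<exists>N :: nat.
           real N \<le> 3 / 13 * log2 (real (u 1) - 1) + 3 / 13 * (\<Sum>i=2..k. log2 (real (u i)))
                    + 8 * real k + 4 \<and>
           (\<forall>n\<ge>N. \<exists>X. orthogonal_design (2 ^ n * (\<Sum>j=1..k. u j)) k (\<lambda>i. 2 ^ n * u i) X)"
proof -
  have "\<exists>l. golay_sum l (u i) \<and> real l \<le> 3 / 26 * log2 (real (u i)) + 4" if "i \<in> {1..k}" for i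
    using golay_sum_log[OF assms(2)[OF that]] log2_eq_log[OF assms(2)[OF that]] by simp
  then obtain l where l: "\<And>i. i \<in> {1..k} \<Longrightarrow> golay_sum (l i) (u i)"
      "\<And>i. i \<in> {1..k} \<Longrightarrow> real (l i) \<le> 3 / 26 * log2 (real (u i)) + 4"
    by metis
  obtain B where B: "golay_blocks B" "length B \<le> (\<Sum>i=1..k. l i)" "blocks_length B = (\<Sum>i=1..k. u i)"
      "\<And>x. blocks_norm B x = (\<Sum>i=1..k. real (u i) * (x i)\<^sup>2)" "fst ` set B \<subseteq> {1..k}"
    using golay_blocks_exist[of k l u, OF l(1)] by blast
  have "real (length B) \<le> (\<Sum>i=1..k. real (l i))"
    using B(2) by (simp flip: of_nat_sum)
  also have "\<dots> \<le> (\<Sum>i=1..k. 3 / 26 * log2 (real (u i)) + 4)"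
    using l(2) by (intro sum_mono) auto
  also have "\<dots> = 3 / 26 * (\<Sum>i=1..k. log2 (real (u i))) + 4 * real k"
    by (simp add: sum.distrib sum_distrib_left)
  also have "(\<Sum>i=1..k. log2 (real (u i))) = log2 (real (u 1)) + (\<Sum>i=2..k. log2 (real (u i)))"
    using assms(1) by (subst sum.atLeast_Suc_atMost) (auto simp: numeral_2_eq_2)
  \<comment> \<open>Doubling turns 3/26 into 3/13 and \<open>4 * k\<close> into
    \<open>8 * k\<close>. Passing from \<open>u 1\<close> to \<open>u 1 - 1\<close> costs another
    3/13, and 3 + 3/13 is below 4.\<close>
  finally have "real (2 * length B + 3) \<le>
      3 / 13 * log2 (real (u 1) - 1) + 3 / 13 * (\<Sum>i=2..k. log2 (real (u i))) + 8 * real k + 4"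
    using log2_pred[OF assms(2)[of 1]] assms(1) by (simp add: field_simps)
  moreover have var: "block_var B p \<in> {1..k}" if "p < blocks_length B" for p
    using block_var_in[OF that] B(5) by blast
  have "\<exists>X. orthogonal_design (2 ^ n * (\<Sum>j=1..k. u j)) k (\<lambda>i. 2 ^ n * u i) X"
    if "2 * length B + 3 \<le> n" for n
    unfolding B(3)[symmetric] by (rule orthogonal_design_of_blocks[OF B(1) assms(2) var B(4) that])
  ultimately show ?thesis by blast
qed

end
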